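(* Let $A\in\mathbb{R}^{m\times n}$ and $b\in\mathbb{R}^m$ be such that $Ax=b$ is consistent, with $Ax^*=b$, let $B\in\mathbb{R}^{n\times n}$ be symmetric positive definite, and let $\{x^k\}_{k\ge0}$ be the random iterates of the randomized iterative method defined in the context, started from $x^0\in\mathbb{R}^n$. If $\mathbf{E}[Z]$ is positive definite, then for every $k\ge0$ $$\mathbf{E}\left[\|x^k-x^*\|_B^2\right]\le\rho^k\|x^0-x^*\|_B^2,$$ where $\rho=1-\lambda_{\min}(B^{-1/2}\mathbf{E}[Z]B^{-1/2})<1$.
   Context: $M^\dagger$ is the Moore-Penrose pseudoinverse, $\lambda_{\min}$ the smallest eigenvalue, and $\|x\|_B=\sqrt{x^TBx}$ for $x\in\mathbb{R}^n$. Method: let $S$ be a random real matrix with $m$ rows and $q$ columns ($q$ may be random). At each iteration $k\ge0$ an independent copy $S_k$ of $S$ is drawn (i.i.d. across iterations), and $$x^{k+1}=x^k-B^{-1}A^TS_k(S_k^TAB^{-1}A^TS_k)^{\dagger}S_k^T(Ax^k-b).$$ Set $Z=A^TS(S^TAB^{-1}A^TS)^{\dagger}S^TA$. *)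

theory Defs
  imports
    "HOL-Probability.Probability"
    "Jordan_Normal_Form.Spectral_Radius"
    "Jordan_Normal_Form.Gauss_Jordan_Elimination"
begin

definition is_pseudo_inverse :: "real mat \<Rightarrow> real mat \<Rightarrow> bool" where
  "is_pseudo_inverse M P \<longleftrightarrow>
     P \<in> carrier_mat (dim_col M) (dim_row M) \<and>
     M * P * M = M \<and>
     P * M * P = P \<and>
     transpose_mat (M * P) = M * P \<and>
     transpose_mat (P * M) = P * M"

definition pseudo_inverse :: "real mat \<Rightarrow> real mat" where
  "pseudo_inverse M = (THE P. is_pseudo_inverse M P)"

definition symmetric_mat :: "real mat \<Rightarrow> bool" where
  "symmetric_mat M \<longleftrightarrow> transpose_mat M = M"

(* Symmetry is deliberately not part of this definition. *)
definition pos_def_mat :: "real mat \<Rightarrow> bool" where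
  "pos_def_mat M \<longleftrightarrow> dim_row M = dim_col M \<and>
     (\<forall>v \<in> carrier_vec (dim_col M). v \<noteq> 0\<^sub>v (dim_col M) \<longrightarrow> scalar_prod v (M *\<^sub>v v) > 0)"

(* Meaningful for invertible square matrices only. *)
definition inv_mat :: "real mat \<Rightarrow> real mat" where
  "inv_mat M = the (mat_inverse M)"

(* The principal square root; meaningful for symmetric positive definite matrices only. *)
definition sqrt_mat :: "real mat \<Rightarrow> real mat" where
  "sqrt_mat M = (THE R. R \<in> carrier_mat (dim_row M) (dim_row M) \<and>
     symmetric_mat R \<and> pos_def_mat R \<and> R * R = M)"

(* The spectrum consists of the real eigenvalues, which for a symmetric matrix is all of them. *)
definition min_eigenvalue :: "real mat \<Rightarrow> real" where
  "min_eigenvalue M = Min (spectrum M)"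

definition norm_mat :: "real mat \<Rightarrow> real vec \<Rightarrow> real" where
  "norm_mat B x = sqrt (scalar_prod x (B *\<^sub>v x))"

(* The Borel sigma-algebra on the disjoint union, over all q, of the spaces of m by q matrices
   (so the number of columns of a random matrix may itself be random). It is generated by the
   lower orthants of the individual spaces; for m = 0 or q = 0 the orthant is the whole
   one-point space. *)
definition borel_mat :: "nat \<Rightarrow> real mat measure" where
  "borel_mat m = sigma {S. dim_row S = m}
     {{S \<in> carrier_mat m q. \<forall>i<m. \<forall>j<q. S $$ (i, j) \<le> c i j} | q c. True}"

definition expectation_mat :: "'a measure \<Rightarrow> nat \<Rightarrow> nat \<Rightarrow> ('a \<Rightarrow> real mat) \<Rightarrow> real mat" where
  "expectation_mat M r c X = mat r c (\<lambda>(i, j). \<integral>\<omega>. X \<omega> $$ (i, j) \<partial>M)"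

definition sketch_core :: "real mat \<Rightarrow> real mat \<Rightarrow> real mat \<Rightarrow> real mat" where
  "sketch_core A B S =
     S * pseudo_inverse (transpose_mat S * A * inv_mat B * transpose_mat A * S) * transpose_mat S"

definition Z_mat :: "real mat \<Rightarrow> real mat \<Rightarrow> real mat \<Rightarrow> real mat" where
  "Z_mat A B S = transpose_mat A * sketch_core A B S * A"

primrec iterate :: "real mat \<Rightarrow> real mat \<Rightarrow> real vec \<Rightarrow> (nat \<Rightarrow> real mat) \<Rightarrow> real vec \<Rightarrow> nat \<Rightarrow> real vec"
where
  "iterate A B b S x0 0 = x0"
| "iterate A B b S x0 (Suc k) =
     (let x = iterate A B b S x0 k
      in x - (inv_mat B * transpose_mat A * sketch_core A B (S k)) *\<^sub>v (A *\<^sub>v x - b))"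

end

theory Submission
  imports Defs
begin

text \<open>
  Writing \<open>e = x - xstar\<close> for the error, one step is \<open>e \<mapsto> (I - B\<inverse> Z) e\<close>. The defining equations of
  the pseudoinverse give \<open>Z B\<inverse> Z = Z\<close>, so the step is a \<open>B\<close>-orthogonal projection and decreases
  the squared \<open>B\<close>-norm of \<open>e\<close> by exactly \<open>e\<^sup>T Z e\<close>. Since \<open>e\<close> is independent of the current sample, this
  decrease has expectation \<open>E[e\<^sup>T E[Z] e]\<close>, which a Rayleigh quotient estimate for
  \<open>B\<^sup>-\<^sup>1\<^sup>/\<^sup>2 E[Z] B\<^sup>-\<^sup>1\<^sup>/\<^sup>2\<close> bounds from below. Measurability of \<open>Z\<close> as a function of the sample holds because
  the pseudoinverse of a symmetric matrix is the limit of the Landweber iteration, whose iterates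
  are rational functions of the entries.
\<close>

unbundle no vec_syntax
unbundle no inner_syntax

section \<open>The spectral theorem\<close>

text \<open>Inverse, principal square root and pseudoinverse are all functions of a symmetric
  matrix, so one diagonalisation serves all three and reduces their defining identities to scalar
  ones, with \<open>inverse 0 = 0\<close> taking care of singular matrices. The pseudoinverse jumps
  where the rank drops, so its measurability cannot come from continuity; the convergence of the
  iteration only has to be pointwise. The number of columns of a sample may be random, hence
  measurability is checked separately on each of the countably many spaces
  \<open>carrier_mat m q\<close>. The samples come without moment bounds, so every integrability
  claim rests on the pointwise sandwich 0 <= Z <= B of quadratic forms, which bounds the entries of
  Z by constants and keeps the error bounded along every path. The same sandwich passes to E[Z] and
  gives \<rho> >= 0, without which the contraction could not be iterated.\<close>

lemma mat_assoc:
  fixes A B C :: "'a :: semiring_0 mat"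
  assumes "dim_col A = dim_row B" "dim_col B = dim_row C"
  shows "A * B * C = A * (B * C)"
  using assms by (intro assoc_mult_mat[of A "dim_row A" "dim_col A" B "dim_col B" C "dim_col C"]) auto

lemma mat_vec_assoc:
  fixes A B :: "'a :: semiring_0 mat"
  assumes "dim_col A = dim_row B" "dim_col B = dim_vec v"
  shows "(A * B) *\<^sub>v v = A *\<^sub>v (B *\<^sub>v v)"
  using assms by (intro assoc_mult_mat_vec[of A "dim_row A" "dim_col A" B "dim_col B"]) auto

lemma mat_transpose_mult:
  fixes A B :: "'a :: comm_semiring_0 mat"
  assumes "dim_col A = dim_row B"
  shows "transpose_mat (A * B) = transpose_mat B * transpose_mat A"
  using assms by (intro transpose_mult[of A "dim_row A" "dim_col A" B "dim_col B"]) auto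

definition orthonormal_mat :: "nat \<Rightarrow> real mat \<Rightarrow> bool" where
  "orthonormal_mat n U \<longleftrightarrow> U \<in> carrier_mat n n \<and> transpose_mat U * U = 1\<^sub>m n"

definition diagonal :: "nat \<Rightarrow> (nat \<Rightarrow> real) \<Rightarrow> real mat" where
  "diagonal n d = mat n n (\<lambda>(i, j). if i = j then d i else 0)"

lemma orthonormal_carrier: "orthonormal_mat n U \<Longrightarrow> U \<in> carrier_mat n n"
  by (simp add: orthonormal_mat_def)

lemma orthonormal_left: "orthonormal_mat n U \<Longrightarrow> transpose_mat U * U = 1\<^sub>m n"
  by (simp add: orthonormal_mat_def)

lemma orthonormal_right: "orthonormal_mat n U \<Longrightarrow> U * transpose_mat U = 1\<^sub>m n"
  unfolding orthonormal_mat_def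
  by (metis mat_mult_left_right_inverse transpose_carrier_mat)

lemma diagonal_carrier [simp]: "diagonal n d \<in> carrier_mat n n"
  by (simp add: diagonal_def)

text \<open>The complexification \<open>C\<close> has some eigenvalue \<open>l\<close> with
  eigenvector \<open>z\<close>. Moving the symmetric \<open>C\<close> across the Hermitian product,
  and using that its entries are real, gives
  \<open>l * (z \<bullet>c z) = cnj l * (z \<bullet>c z)\<close>, so \<open>l\<close> is
  real.\<close>

lemma symmetric_real_eigenvalue_exists:
  fixes A :: "real mat"
  assumes A: "A \<in> carrier_mat n n" and sym: "transpose_mat A = A" and n: "n > 0"
  shows "\<exists>e. eigenvalue A e"
proof -
  define C where "C = map_mat complex_of_real A"
  have C: "C \<in> carrier_mat n n" and symC: "transpose_mat C = C"
    using A sym by (auto simp: C_def map_mat_transpose)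
  from spectrum_non_empty[OF C n] obtain l where l: "eigenvalue C l"
    by (auto simp: spectrum_def)
  then obtain z where z: "z \<in> carrier_vec n" "z \<noteq> 0\<^sub>v n" and Cz: "C *\<^sub>v z = l \<cdot>\<^sub>v z"
    using C by (auto simp: eigenvalue_def eigenvector_def)
  have conj: "C *\<^sub>v conjugate z = conjugate (C *\<^sub>v z)"
    using A z by (intro eq_vecI) (auto simp: C_def scalar_prod_def)
  have "l * (z \<bullet>c z) = (C *\<^sub>v z) \<bullet>c z"
    using z by (simp add: Cz)
  also have "\<dots> = z \<bullet> (C *\<^sub>v conjugate z)"
    using transpose_vec_mult_scalar[OF C, of "conjugate z" z] z symC by simp
  also have "\<dots> = cnj l * (z \<bullet>c z)"
    using z by (simp add: conj Cz conjugate_smult_vec)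
  finally have "cnj l = l"
    using z by simp
  then obtain t where t: "l = complex_of_real t"
    by (metis Reals_cases Reals_cnj_iff)
  \<comment> \<open>The eigenvector \<open>z\<close> may be genuinely complex, so the return to the
    reals goes through the root of the characteristic polynomial.\<close>
  have "poly (map_poly complex_of_real (char_poly A)) (complex_of_real t) = 0"
    using l eigenvalue_root_char_poly[OF C] of_real_hom.char_poly_hom[OF A, where ?'a=complex]
    by (simp add: C_def t)
  then have "poly (char_poly A) t = 0"
    by simp
  then show ?thesis
    using eigenvalue_root_char_poly[OF A] by blast
qed

text \<open>Gram-Schmidt applied to a basis that begins with \<open>v\<close> leaves
  \<open>v\<close> in place; normalising afterwards only rescales it. The scalar \<open>c\<close>
  stays anonymous because an eigenvector is needed only up to scaling.\<close>

lemma orthonormal_basis_extension: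
  fixes v :: "real vec"
  assumes v: "v \<in> carrier_vec n" "v \<noteq> 0\<^sub>v n"
  obtains U c where "orthonormal_mat n U" "col U 0 = c \<cdot>\<^sub>v v"
proof -
  interpret cof_vec_space n "TYPE(real)" .
  define b where "b = basis_completion v"
  define ws where "ws = gram_schmidt n b"
  note bc = basis_completion[OF v, folded b_def]
  have n: "n > 0"
    using v by (cases n) auto
  then obtain vs where bv: "b = v # vs"
    using bc(6,7) by (cases b) auto
  note gs = gram_schmidt_result[OF bc(2,4,5) refl, folded ws_def]
  have ws: "set ws \<subseteq> carrier_vec n" "corthogonal ws" "length ws = n"
    using gs bc(6) by auto
  have hd: "ws ! 0 = v"
    using gram_schmidt_hd[OF v(1), of vs, folded bv ws_def] ws(3) n
    by (cases ws) auto
  define U where "U = mat n n (\<lambda>(i, j). (ws ! j) $ i / sqrt ((ws ! j) \<bullet> (ws ! j)))"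
  have wsc: "ws ! j \<in> carrier_vec n" if "j < n" for j
    using ws that by auto
  have conj: "conjugate w = w" for w :: "real vec"
    by (rule eq_vecI) auto
  have orth: "ws ! i \<bullet> ws ! j = 0 \<longleftrightarrow> i \<noteq> j" if "i < n" "j < n" for i j
    using corthogonalD[OF ws(2), of i j] that ws(3) by (simp add: conj)
  have pos: "ws ! i \<bullet> ws ! i > 0" if "i < n" for i
  proof -
    have "ws ! i \<bullet> ws ! i \<ge> 0"
      by (auto simp: scalar_prod_def intro: sum_nonneg)
    with orth[OF that that] show ?thesis by simp
  qed
  have "orthonormal_mat n U"
    unfolding orthonormal_mat_def
  proof
    show "transpose_mat U * U = 1\<^sub>m n"
    proof (rule eq_matI)
      fix i j assume "i < dim_row (1\<^sub>m n :: real mat)" "j < dim_col (1\<^sub>m n :: real mat)"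
      then have ij: "i < n" "j < n" by auto
      have "(transpose_mat U * U) $$ (i, j) =
          (\<Sum>k<n. ((ws ! i) $ k * (ws ! j) $ k) / (sqrt (ws ! i \<bullet> ws ! i) * sqrt (ws ! j \<bullet> ws ! j)))"
        using ij by (auto simp: U_def scalar_prod_def atLeast0LessThan intro!: sum.cong)
      also have "\<dots> = (ws ! i \<bullet> ws ! j) / (sqrt (ws ! i \<bullet> ws ! i) * sqrt (ws ! j \<bullet> ws ! j))"
        using wsc[OF ij(2)] by (simp add: scalar_prod_def sum_divide_distrib atLeast0LessThan)
      also have "\<dots> = (1\<^sub>m n) $$ (i, j)"
        using ij orth pos by (auto simp: less_imp_le)
      finally show "(transpose_mat U * U) $$ (i, j) = (1\<^sub>m n) $$ (i, j)" .
    qed (auto simp: U_def)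
  qed (simp add: U_def)
  moreover have "col U 0 = (1 / sqrt (v \<bullet> v)) \<cdot>\<^sub>v v"
    using n v by (intro eq_vecI) (auto simp: U_def hd)
  ultimately show ?thesis
    using that by blast
qed

lemma orthonormal_dim: "orthonormal_mat n U \<Longrightarrow> dim_row U = n" "orthonormal_mat n U \<Longrightarrow> dim_col U = n"
  by (auto simp: orthonormal_mat_def)

lemma diagonal_dim [simp]: "dim_row (diagonal n d) = n" "dim_col (diagonal n d) = n"
  by (simp_all add: diagonal_def)

lemma orthonormal_cancel:
  assumes "orthonormal_mat n U" "dim_row A = n"
  shows "transpose_mat U * (U * A) = A" "U * (transpose_mat U * A) = A"
proof -
  note d = orthonormal_dim[OF assms(1)]
  show "transpose_mat U * (U * A) = A"
    using mat_assoc[of "transpose_mat U" U A] assms d by (simp add: orthonormal_left)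
  show "U * (transpose_mat U * A) = A"
    using mat_assoc[of U "transpose_mat U" A] assms d by (simp add: orthonormal_right)
qed

lemma orthonormal_mult:
  assumes U: "orthonormal_mat n U" and V: "orthonormal_mat n V"
  shows "orthonormal_mat n (U * V)"
proof -
  note [simp] = orthonormal_dim[OF U] orthonormal_dim[OF V]
  have "transpose_mat (U * V) * (U * V) = 1\<^sub>m n"
    by (simp add: mat_transpose_mult mat_assoc orthonormal_cancel[OF U] orthonormal_left[OF V])
  moreover have "U * V \<in> carrier_mat n n"
    by (rule carrier_matI) simp_all
  ultimately show ?thesis
    by (simp add: orthonormal_mat_def)
qed

text \<open>Deflation: conjugation by an orthonormal \<open>U\<close> whose column 0 is an
  eigenvector clears column 0 of \<open>A'\<close> below the diagonal, and symmetry clears row 0 as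
  well. What remains is a symmetric block of size \<open>k\<close>, to which the induction
  hypothesis applies.\<close>

theorem spectral_theorem:
  fixes A :: "real mat"
  assumes "A \<in> carrier_mat n n" "transpose_mat A = A"
  shows "\<exists>U d. orthonormal_mat n U \<and> A = U * diagonal n d * transpose_mat U"
  using assms
proof (induction n arbitrary: A)
  case 0
  then have "orthonormal_mat 0 (1\<^sub>m 0) \<and>
      A = 1\<^sub>m 0 * diagonal 0 (\<lambda>_. 0) * transpose_mat (1\<^sub>m 0)"
    by (auto simp: orthonormal_mat_def intro!: eq_matI)
  then show ?case by blast
next
  case (Suc k)
  let ?n = "Suc k"
  note A = Suc.prems(1)
  from symmetric_real_eigenvalue_exists[OF Suc.prems] obtain e v
    where v: "v \<in> carrier_vec ?n" "v \<noteq> 0\<^sub>v ?n" and Av: "A *\<^sub>v v = e \<cdot>\<^sub>v v"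
    using A by (auto simp: eigenvalue_def eigenvector_def)
  obtain U c where U: "orthonormal_mat ?n U" and U0: "col U 0 = c \<cdot>\<^sub>v v"
    using orthonormal_basis_extension[OF v] .
  have [simp]: "dim_row A = ?n" "dim_col A = ?n" "dim_row U = ?n" "dim_col U = ?n" "dim_vec v = ?n"
    using A v orthonormal_dim[OF U] by auto
  define A' where "A' = transpose_mat U * A * U"
  have [simp]: "dim_row A' = ?n" "dim_col A' = ?n"
    by (simp_all add: A'_def)
  have A'sym: "transpose_mat A' = A'"
    by (simp add: A'_def mat_transpose_mult mat_assoc Suc.prems(2))
  have AA': "A = U * A' * transpose_mat U"
    by (simp add: A'_def mat_assoc orthonormal_cancel[OF U] orthonormal_right[OF U])
  have "col A' 0 = A' *\<^sub>v unit_vec ?n 0"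
    by (intro eq_vecI) auto
  also have "\<dots> = transpose_mat U *\<^sub>v (A *\<^sub>v (U *\<^sub>v unit_vec ?n 0))"
    by (simp add: A'_def mat_vec_assoc)
  also have "U *\<^sub>v unit_vec ?n 0 = col U 0"
    by (intro eq_vecI) auto
  also have "A *\<^sub>v col U 0 = e \<cdot>\<^sub>v col U 0"
    using v A by (simp add: U0 Av mult_mat_vec[of _ ?n ?n] smult_smult_assoc mult.commute)
  also have "transpose_mat U *\<^sub>v (e \<cdot>\<^sub>v col U 0) = e \<cdot>\<^sub>v col (transpose_mat U * U) 0"
    by (intro eq_vecI) auto
  also have "\<dots> = e \<cdot>\<^sub>v unit_vec ?n 0"
    by (simp add: orthonormal_left[OF U])
  finally have c0: "col A' 0 = e \<cdot>\<^sub>v unit_vec ?n 0" .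
  have A'0: "A' $$ (i, 0) = (if i = 0 then e else 0)" if "i < ?n" for i
  proof -
    have "A' $$ (i, 0) = col A' 0 $ i"
      using that by simp
    then show ?thesis
      using that by (simp add: c0 del: index_col)
  qed
  have A'0': "A' $$ (0, i) = (if i = 0 then e else 0)" if "i < ?n" for i
  proof -
    have "A' $$ (0, i) = transpose_mat A' $$ (i, 0)"
      using that by simp
    then show ?thesis
      using that A'0 A'sym by simp
  qed
  define A3 where "A3 = mat k k (\<lambda>(i, j). A' $$ (Suc i, Suc j))"
  have A3c: "A3 \<in> carrier_mat k k"
    by (simp add: A3_def)
  have A3sym: "transpose_mat A3 = A3"
  proof (rule eq_matI)
    fix i j assume "i < dim_row A3" "j < dim_col A3"
    then have ij: "i < k" "j < k" by (auto simp: A3_def)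
    have "A' $$ (Suc j, Suc i) = transpose_mat A' $$ (Suc i, Suc j)"
      using ij by simp
    then show "transpose_mat A3 $$ (i, j) = A3 $$ (i, j)"
      using ij by (simp add: A3_def A'sym)
  qed (auto simp: A3_def)
  obtain V d where V: "orthonormal_mat k V" and A3: "A3 = V * diagonal k d * transpose_mat V"
    using Suc.IH[OF A3c A3sym] by blast
  note Vc [simp] = orthonormal_carrier[OF V]
  \<comment> \<open>Bordering \<open>V\<close> by a 1 fixes the eigenvector already split off and
    diagonalises the complementary block.\<close>
  define W where "W = four_block_mat (1\<^sub>m 1) (0\<^sub>m 1 k) (0\<^sub>m k 1) V"
  have Wt: "transpose_mat W = four_block_mat (1\<^sub>m 1) (0\<^sub>m 1 k) (0\<^sub>m k 1) (transpose_mat V)"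
    by (simp add: W_def transpose_four_block_mat[of _ 1 1 _ k _ k])
  have z: "0\<^sub>m r k * X = 0\<^sub>m r k" "X * 0\<^sub>m k r = 0\<^sub>m k r" if "X \<in> carrier_mat k k" for X :: "real mat" and r
    using that by auto
  have block: "four_block_mat P (0\<^sub>m 1 k) (0\<^sub>m k 1) X * four_block_mat Q (0\<^sub>m 1 k) (0\<^sub>m k 1) Y
      = four_block_mat (P * Q) (0\<^sub>m 1 k) (0\<^sub>m k 1) (X * Y)"
    if "X \<in> carrier_mat k k" "Y \<in> carrier_mat k k" "P \<in> carrier_mat 1 1" "Q \<in> carrier_mat 1 1"
    for P Q X Y :: "real mat"
    using that mult_carrier_mat[OF that(1,2)] mult_carrier_mat[OF that(3,4)]
    by (subst mult_four_block_mat[of _ 1 1 _ k _ k _ _ 1 _ k]) (auto simp: z)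
  have "transpose_mat W * W = four_block_mat (1\<^sub>m 1) (0\<^sub>m 1 k) (0\<^sub>m k 1) (1\<^sub>m k)"
    using V unfolding Wt by (simp add: W_def block orthonormal_left del: One_nat_def)
  also have "\<dots> = 1\<^sub>m ?n"
    by (rule eq_matI) auto
  finally have W: "orthonormal_mat ?n W"
    unfolding orthonormal_mat_def by (auto simp: W_def orthonormal_dim[OF V])
  have [simp]: "dim_row W = ?n" "dim_col W = ?n"
    using orthonormal_dim[OF W] by auto
  \<comment> \<open>\<open>case_nat e d\<close> is the sequence \<open>e, d 0, d 1, ...\<close>,
    with the new eigenvalue in front.\<close>
  define D where "D = diagonal ?n (case_nat e d)"
  have D: "D = four_block_mat (mat 1 1 (\<lambda>_. e)) (0\<^sub>m 1 k) (0\<^sub>m k 1) (diagonal k d)"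
    by (rule eq_matI) (auto simp: D_def diagonal_def split: nat.split)
  have [simp]: "dim_row D = ?n" "dim_col D = ?n"
    by (simp_all add: D_def)
  have A'b: "A' = four_block_mat (mat 1 1 (\<lambda>_. e)) (0\<^sub>m 1 k) (0\<^sub>m k 1) A3"
    by (rule eq_matI) (auto simp: A3_def A'0 A'0')
  have "A' = W * D * transpose_mat W"
    unfolding Wt A'b unfolding D W_def A3
    by (simp add: block mult_carrier_mat[of _ k k _ k] del: One_nat_def)
  then have "A = (U * W) * D * transpose_mat (U * W)"
    by (subst AA') (simp add: mat_transpose_mult mat_assoc)
  then show ?case
    using orthonormal_mult[OF U W] D_def by blast
qed

section \<open>Functional calculus for symmetric matrices\<close>

lemma scalar_prod_self_nonneg: "v \<bullet> v \<ge> (0 :: real)"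
  by (auto simp: scalar_prod_def intro: sum_nonneg)

lemma scalar_prod_self_pos:
  fixes v :: "real vec"
  assumes "v \<in> carrier_vec n" "v \<noteq> 0\<^sub>v n"
  shows "v \<bullet> v > 0"
proof -
  have "conjugate v = v"
    by (rule eq_vecI) auto
  then have "v \<bullet> v \<noteq> 0"
    using conjugate_square_eq_0_vec[OF assms(1)] assms(2) by simp
  then show ?thesis
    using scalar_prod_self_nonneg[of v] by simp
qed

lemma scalar_prod_transpose:
  fixes A :: "'a :: comm_semiring_0 mat"
  assumes "dim_row A = dim_vec v" "dim_col A = dim_vec w"
  shows "v \<bullet> (A *\<^sub>v w) = (transpose_mat A *\<^sub>v v) \<bullet> w"
  by (rule transpose_vec_mult_scalar[of A "dim_row A" "dim_col A" w v, symmetric])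
    (use assms in auto)

text \<open>The function \<open>f\<close> of the eigenvalue index plays the role of the spectrum.
  For a fixed orthonormal \<open>U\<close>, the map from \<open>f\<close> to
  \<open>spectral_mat n U f\<close> respects sums, products and scalars, so matrix identities can be
  checked eigenvalue by eigenvalue.\<close>

definition spectral_mat :: "nat \<Rightarrow> real mat \<Rightarrow> (nat \<Rightarrow> real) \<Rightarrow> real mat" where
  "spectral_mat n U f = U * diagonal n f * transpose_mat U"

context
  fixes n :: nat and U :: "real mat"
  assumes U: "orthonormal_mat n U"
begin

lemmas U_dim [simp] = orthonormal_dim[OF U]

lemma spectral_mat_dim [simp]:
  "dim_row (spectral_mat n U f) = n" "dim_col (spectral_mat n U f) = n"
  by (simp_all add: spectral_mat_def)

lemma spectral_mat_carrier [simp]: "spectral_mat n U f \<in> carrier_mat n n"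
  by (rule carrier_matI) simp_all

lemma spectral_mat_index:
  assumes "i < n" "j < n"
  shows "spectral_mat n U f $$ (i, j) = (\<Sum>k<n. U $$ (i, k) * f k * U $$ (j, k))"
proof -
  have "(U * diagonal n f) $$ (i, k) = U $$ (i, k) * f k" if "k < n" for k
  proof -
    show ?thesis
      using assms that by (simp add: scalar_prod_def diagonal_def atLeast0LessThan mult_delta_right)
  qed
  then show ?thesis
    unfolding spectral_mat_def using assms
    by (subst index_mult_mat) (auto simp: scalar_prod_def atLeast0LessThan intro!: sum.cong)
qed

lemma spectral_mat_cong: "(\<And>i. i < n \<Longrightarrow> f i = g i) \<Longrightarrow> spectral_mat n U f = spectral_mat n U g"
  by (rule eq_matI) (auto simp: spectral_mat_index intro!: sum.cong)

lemma spectral_mat_symmetric [simp]: "transpose_mat (spectral_mat n U f) = spectral_mat n U f"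
  by (rule eq_matI) (auto simp: spectral_mat_index mult_ac)

lemma spectral_mat_add: "spectral_mat n U f + spectral_mat n U g = spectral_mat n U (\<lambda>i. f i + g i)"
  by (rule eq_matI) (auto simp: spectral_mat_index algebra_simps sum.distrib)

lemma spectral_mat_minus: "spectral_mat n U f - spectral_mat n U g = spectral_mat n U (\<lambda>i. f i - g i)"
  by (rule eq_matI) (auto simp: spectral_mat_index algebra_simps sum_subtractf)

lemma spectral_mat_smult: "c \<cdot>\<^sub>m spectral_mat n U f = spectral_mat n U (\<lambda>i. c * f i)"
  by (rule eq_matI) (auto simp: spectral_mat_index sum_distrib_left mult_ac)

lemma spectral_mat_zero: "spectral_mat n U (\<lambda>_. 0) = 0\<^sub>m n n"
  by (rule eq_matI) (auto simp: spectral_mat_index)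

lemma spectral_mat_one: "spectral_mat n U (\<lambda>_. 1) = 1\<^sub>m n"
proof -
  have "diagonal n (\<lambda>_. 1) = 1\<^sub>m n"
    by (rule eq_matI) (auto simp: diagonal_def)
  then show ?thesis
    by (simp add: spectral_mat_def orthonormal_right[OF U])
qed

lemma spectral_mat_mult: "spectral_mat n U f * spectral_mat n U g = spectral_mat n U (\<lambda>i. f i * g i)"
proof -
  have "diagonal n f * diagonal n g = diagonal n (\<lambda>i. f i * g i)"
  proof (rule eq_matI)
    fix i j assume "i < dim_row (diagonal n (\<lambda>i. f i * g i))" "j < dim_col (diagonal n (\<lambda>i. f i * g i))"
    then have ij: "i < n" "j < n" by auto
    then show "(diagonal n f * diagonal n g) $$ (i, j) = diagonal n (\<lambda>i. f i * g i) $$ (i, j)"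
      by (simp add: scalar_prod_def diagonal_def atLeast0LessThan mult_delta_left)
  qed auto
  moreover have "spectral_mat n U f * spectral_mat n U g
      = U * (diagonal n f * diagonal n g) * transpose_mat U"
    by (simp add: spectral_mat_def mat_assoc orthonormal_cancel[OF U])
  ultimately show ?thesis
    by (simp add: spectral_mat_def)
qed

lemma col_carrier [simp]: "col U k \<in> carrier_vec n"
  using col_dim[of U k] by simp

lemma col_orthonormal: "i < n \<Longrightarrow> j < n \<Longrightarrow> col U i \<bullet> col U j = (if i = j then 1 else 0)"
proof -
  assume ij: "i < n" "j < n"
  then have "col U i \<bullet> col U j = (transpose_mat U * U) $$ (i, j)"
    by simp
  then show ?thesis
    using ij by (simp only: orthonormal_left[OF U]) simp
qed

lemma spectral_mat_vec_index:
  assumes "v \<in> carrier_vec n" "i < n"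
  shows "(spectral_mat n U f *\<^sub>v v) $ i = (\<Sum>k<n. f k * (col U k \<bullet> v) * U $$ (i, k))"
proof -
  have "(spectral_mat n U f *\<^sub>v v) $ i = (\<Sum>j<n. (\<Sum>k<n. U $$ (i, k) * f k * U $$ (j, k)) * v $ j)"
    using assms by (auto simp: scalar_prod_def spectral_mat_index atLeast0LessThan intro!: sum.cong)
  also have "\<dots> = (\<Sum>k<n. \<Sum>j<n. U $$ (i, k) * f k * U $$ (j, k) * v $ j)"
    by (subst sum.swap) (simp add: sum_distrib_right)
  also have "\<dots> = (\<Sum>k<n. f k * (col U k \<bullet> v) * U $$ (i, k))"
    using assms by (auto simp: scalar_prod_def atLeast0LessThan sum_distrib_left sum_distrib_right mult_ac intro!: sum.cong)
  finally show ?thesis .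
qed

lemma spectral_mat_eigenvector:
  assumes "k < n"
  shows "spectral_mat n U f *\<^sub>v col U k = f k \<cdot>\<^sub>v col U k"
proof (rule eq_vecI)
  fix i assume "i < dim_vec (f k \<cdot>\<^sub>v col U k)"
  then have i: "i < n" by simp
  have "(spectral_mat n U f *\<^sub>v col U k) $ i = (\<Sum>l<n. f l * (col U l \<bullet> col U k) * U $$ (i, l))"
    by (rule spectral_mat_vec_index[OF col_carrier i])
  also have "\<dots> = (\<Sum>l<n. if l = k then f l * U $$ (i, l) else 0)"
    by (rule sum.cong) (use assms col_orthonormal in auto)
  finally have "(spectral_mat n U f *\<^sub>v col U k) $ i = (\<Sum>l<n. if l = k then f l * U $$ (i, l) else 0)" .
  then show "(spectral_mat n U f *\<^sub>v col U k) $ i = (f k \<cdot>\<^sub>v col U k) $ i"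
    using assms i by simp
qed simp

lemma spectral_mat_quadratic:
  assumes v: "v \<in> carrier_vec n"
  shows "v \<bullet> (spectral_mat n U f *\<^sub>v v) = (\<Sum>k<n. f k * (col U k \<bullet> v)\<^sup>2)"
proof -
  have "v \<bullet> (spectral_mat n U f *\<^sub>v v) = (\<Sum>i<n. \<Sum>k<n. v $ i * (f k * (col U k \<bullet> v) * U $$ (i, k)))"
    using v by (auto simp: scalar_prod_def[of v] spectral_mat_vec_index atLeast0LessThan sum_distrib_left
        simp del: index_mult_mat_vec intro!: sum.cong)
  also have "\<dots> = (\<Sum>k<n. f k * (col U k \<bullet> v) * (\<Sum>i<n. U $$ (i, k) * v $ i))"
    by (subst sum.swap) (simp add: sum_distrib_left mult_ac)
  also have "\<dots> = (\<Sum>k<n. f k * (col U k \<bullet> v) * (col U k \<bullet> v))"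
    using v by (auto simp: scalar_prod_def atLeast0LessThan intro!: sum.cong)
  finally show ?thesis
    by (simp add: power2_eq_square mult_ac)
qed

lemma parseval: "v \<in> carrier_vec n \<Longrightarrow> (\<Sum>k<n. (col U k \<bullet> v)\<^sup>2) = v \<bullet> v"
  using spectral_mat_quadratic[of v "\<lambda>_. 1"] by (simp add: spectral_mat_one)

lemma col_orthonormal_nonzero: "k < n \<Longrightarrow> col U k \<noteq> 0\<^sub>v n"
  using col_orthonormal[of k k] by auto

text \<open>By Parseval a nonzero \<open>v\<close> has a nonzero coefficient along some column of
  \<open>U\<close>, and the corresponding term makes the diagonalised quadratic form
  positive.\<close>

lemma spectral_mat_pos_def:
  assumes "\<And>i. i < n \<Longrightarrow> f i > 0"
  shows "pos_def_mat (spectral_mat n U f)"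
  unfolding pos_def_mat_def
proof (intro conjI ballI impI)
  fix v :: "real vec"
  assume "v \<in> carrier_vec (dim_col (spectral_mat n U f))" "v \<noteq> 0\<^sub>v (dim_col (spectral_mat n U f))"
  then have v: "v \<in> carrier_vec n" "v \<noteq> 0\<^sub>v n" by auto
  have "(\<Sum>k<n. (col U k \<bullet> v)\<^sup>2) > 0"
    using scalar_prod_self_pos[OF v] parseval[OF v(1)] by simp
  then obtain k where k: "k < n" "(col U k \<bullet> v)\<^sup>2 \<noteq> 0"
    by (metis (no_types, lifting) lessThan_iff less_irrefl sum.neutral)
  have "(\<Sum>k<n. f k * (col U k \<bullet> v)\<^sup>2) > 0"
    using assms k by (intro sum_pos2[of _ k]) (auto simp: less_imp_le)
  then show "v \<bullet> (spectral_mat n U f *\<^sub>v v) > 0"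
    by (simp add: spectral_mat_quadratic[OF v(1)])
qed simp

lemma spectral_mat_pos_defD:
  assumes "pos_def_mat (spectral_mat n U f)" "k < n"
  shows "f k > 0"
proof -
  have "col U k \<bullet> (spectral_mat n U f *\<^sub>v col U k) > 0"
    using assms col_orthonormal_nonzero[of k] by (simp add: pos_def_mat_def)
  then show ?thesis
    using assms(2) by (simp add: spectral_mat_eigenvector col_orthonormal)
qed

end

section \<open>Inverse, square root, smallest eigenvalue and pseudoinverse\<close>

lemma symmetric_spectralE:
  assumes "A \<in> carrier_mat n n" "symmetric_mat A"
  obtains U d where "orthonormal_mat n U" "A = spectral_mat n U d"
  using spectral_theorem[of A n] assms by (auto simp: symmetric_mat_def spectral_mat_def)

lemma pos_def_spectralE:
  assumes "A \<in> carrier_mat n n" "symmetric_mat A" "pos_def_mat A"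
  obtains U d where "orthonormal_mat n U" "A = spectral_mat n U d" "\<And>i. i < n \<Longrightarrow> d i > 0"
  using symmetric_spectralE[OF assms(1,2)] spectral_mat_pos_defD assms(3) by metis

text \<open>A right inverse of a square matrix is two-sided, so \<open>A\<close> is a unit of the
  matrix ring and \<open>mat_inverse\<close> returns \<open>Some C\<close>; then
  \<open>C = C * (A * X) = X\<close>.\<close>

lemma inv_mat_eqI:
  assumes A: "A \<in> carrier_mat n n" and X: "X \<in> carrier_mat n n" and AX: "A * X = 1\<^sub>m n"
  shows "inv_mat A = X"
proof -
  have XA: "X * A = 1\<^sub>m n"
    using mat_mult_left_right_inverse[OF A X AX] .
  then have "A \<in> Units (ring_mat TYPE(real) n ())"
    using A X AX by (auto simp: Units_def ring_mat_simps)
  then obtain C where C: "mat_inverse A = Some C"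
    using mat_inverse(1)[OF A, of "()"] by (cases "mat_inverse A") auto
  have Cc: "C * A = 1\<^sub>m n" "C \<in> carrier_mat n n"
    using mat_inverse(2)[OF A C] by auto
  have "C = C * (A * X)"
    using Cc AX by simp
  also have "\<dots> = X"
    using A X Cc by (subst assoc_mult_mat[symmetric, of _ n n _ n _ n]) auto
  finally show ?thesis
    by (simp add: inv_mat_def C)
qed

lemma inv_mat_spectral:
  assumes U: "orthonormal_mat n U" and d: "\<And>i. i < n \<Longrightarrow> d i \<noteq> 0"
  shows "inv_mat (spectral_mat n U d) = spectral_mat n U (\<lambda>i. inverse (d i))"
proof (rule inv_mat_eqI[of _ n])
  have "spectral_mat n U d * spectral_mat n U (\<lambda>i. inverse (d i)) = spectral_mat n U (\<lambda>_. 1)"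
    unfolding spectral_mat_mult[OF U] using d by (intro spectral_mat_cong[OF U]) simp
  then show "spectral_mat n U d * spectral_mat n U (\<lambda>i. inverse (d i)) = 1\<^sub>m n"
    by (simp add: spectral_mat_one[OF U])
qed (simp_all add: U)

lemma pos_def_inv_mat:
  assumes "A \<in> carrier_mat n n" "symmetric_mat A" "pos_def_mat A"
  shows "inv_mat A \<in> carrier_mat n n" "symmetric_mat (inv_mat A)" "pos_def_mat (inv_mat A)"
    "A * inv_mat A = 1\<^sub>m n" "inv_mat A * A = 1\<^sub>m n"
proof -
  obtain U d where U: "orthonormal_mat n U" and A: "A = spectral_mat n U d" and d: "\<And>i. i < n \<Longrightarrow> d i > 0"
    using pos_def_spectralE[OF assms] by blast
  have I: "inv_mat A = spectral_mat n U (\<lambda>i. inverse (d i))"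
    unfolding A using d by (intro inv_mat_spectral[OF U]) (simp add: less_imp_neq[symmetric])
  show c: "inv_mat A \<in> carrier_mat n n"
    by (simp add: I U)
  show "symmetric_mat (inv_mat A)"
    by (simp add: I U symmetric_mat_def)
  show "pos_def_mat (inv_mat A)"
    unfolding I using d by (intro spectral_mat_pos_def[OF U]) simp
  have "A * inv_mat A = spectral_mat n U (\<lambda>_. 1)"
    unfolding I unfolding A spectral_mat_mult[OF U] using d
    by (intro spectral_mat_cong[OF U]) (simp add: less_imp_neq[symmetric])
  then show AI: "A * inv_mat A = 1\<^sub>m n"
    by (simp add: spectral_mat_one[OF U])
  then show "inv_mat A * A = 1\<^sub>m n"
    using mat_mult_left_right_inverse[OF assms(1) c] by simp
qed

text \<open>The difference \<open>R - Q\<close> is diagonalised, which avoids any question whether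
  \<open>R\<close> and \<open>Q\<close> commute. For an eigenvector \<open>w\<close> with eigenvalue
  \<open>x k\<close>, equality of the squares says that \<open>R w\<close> and \<open>Q w\<close>
  have the same length, and this factors as \<open>x k * (w \<bullet> a + w \<bullet> c) = 0\<close>
  with a positive second factor.\<close>

lemma sqrt_unique:
  assumes R: "R \<in> carrier_mat n n" "symmetric_mat R" "pos_def_mat R"
    and Q: "Q \<in> carrier_mat n n" "symmetric_mat Q" "pos_def_mat Q"
    and eq: "R * R = Q * Q"
  shows "R = Q"
proof -
  have [simp]: "dim_row R = n" "dim_col R = n" "dim_row Q = n" "dim_col Q = n"
    using R Q by auto
  have "symmetric_mat (R - Q)"
    using transpose_minus[OF R(1) Q(1)] R(2) Q(2) by (simp add: symmetric_mat_def)
  moreover have "R - Q \<in> carrier_mat n n"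
    by (rule carrier_matI) simp_all
  ultimately obtain V x where V: "orthonormal_mat n V" and X: "R - Q = spectral_mat n V x"
    using symmetric_spectralE by metis
  note [simp] = orthonormal_dim[OF V]
  have x: "x k = 0" if "k < n" for k
  proof -
    define w where "w = col V k"
    have w: "w \<in> carrier_vec n" "w \<noteq> 0\<^sub>v n"
      using col_orthonormal_nonzero[OF V that] col_carrier[OF V] by (auto simp: w_def)
    have [simp]: "dim_vec w = n" using w by simp
    define a c where "a = R *\<^sub>v w" and "c = Q *\<^sub>v w"
    have ac: "a \<in> carrier_vec n" "c \<in> carrier_vec n"
      unfolding a_def c_def by (auto intro!: carrier_vecI)
    have "a - c = (R - Q) *\<^sub>v w"
      using R Q w by (simp add: a_def c_def minus_mult_distrib_mat_vec[of _ n n])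
    also have "\<dots> = x k \<cdot>\<^sub>v w"
      using that by (simp add: X w_def spectral_mat_eigenvector[OF V])
    finally have diff: "a - c = x k \<cdot>\<^sub>v w" .
    have sq: "(S *\<^sub>v w) \<bullet> (S *\<^sub>v w) = w \<bullet> ((S * S) *\<^sub>v w)"
      if "S \<in> carrier_mat n n" "symmetric_mat S" for S
      using that w by (simp add: mat_vec_assoc scalar_prod_transpose[of S w] symmetric_mat_def)
    have "0 = a \<bullet> a - c \<bullet> c"
      using sq[OF R(1,2)] sq[OF Q(1,2)] eq by (simp add: a_def c_def)
    also have "\<dots> = (a - c) \<bullet> (a + c)"
      using ac by (simp add: minus_scalar_prod_distrib[of _ n] scalar_prod_add_distrib[of _ n] comm_scalar_prod[of c n a])
    also have "\<dots> = x k * (w \<bullet> a + w \<bullet> c)"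
      using ac w by (simp add: diff scalar_prod_add_distrib[of _ n] algebra_simps)
    finally have "x k * (w \<bullet> a + w \<bullet> c) = 0" by simp
    moreover have "w \<bullet> a > 0" "w \<bullet> c > 0"
      using R(3) Q(3) w by (auto simp: pos_def_mat_def a_def c_def)
    ultimately show "x k = 0" by simp
  qed
  have "R - Q = 0\<^sub>m n n"
    unfolding X spectral_mat_zero[OF V, symmetric] using x by (rule spectral_mat_cong[OF V])
  then have "(R - Q) $$ (i, j) = 0" if "i < n" "j < n" for i j
    using that by simp
  then show ?thesis
    by (intro eq_matI) auto
qed

lemma sqrt_mat_pos_def:
  assumes B: "B \<in> carrier_mat n n" "symmetric_mat B" "pos_def_mat B"
  shows "sqrt_mat B \<in> carrier_mat n n" "symmetric_mat (sqrt_mat B)" "pos_def_mat (sqrt_mat B)"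
    "sqrt_mat B * sqrt_mat B = B"
proof -
  obtain U d where U: "orthonormal_mat n U" and Bd: "B = spectral_mat n U d" and d: "\<And>i. i < n \<Longrightarrow> d i > 0"
    using pos_def_spectralE[OF B] by blast
  let ?P = "\<lambda>R. R \<in> carrier_mat (dim_row B) (dim_row B) \<and> symmetric_mat R \<and> pos_def_mat R \<and> R * R = B"
  define R where "R = spectral_mat n U (\<lambda>i. sqrt (d i))"
  have "R * R = B"
    unfolding R_def Bd spectral_mat_mult[OF U] using d
    by (intro spectral_mat_cong[OF U]) (simp add: less_imp_le)
  then have "?P R"
    using B d by (auto simp: R_def U symmetric_mat_def intro!: spectral_mat_pos_def)
  moreover have "Q = R" if "?P Q" for Q
    using that \<open>?P R\<close> sqrt_unique[of Q n R] B(1) by auto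
  ultimately have "?P (sqrt_mat B)"
    unfolding sqrt_mat_def by (intro theI[of ?P R])
  then show "sqrt_mat B \<in> carrier_mat n n" "symmetric_mat (sqrt_mat B)" "pos_def_mat (sqrt_mat B)"
    "sqrt_mat B * sqrt_mat B = B"
    using B(1) by auto
qed

text \<open>The hypothesis \<open>n \<ge> 1\<close> keeps the spectrum nonempty, so that the
  \<open>Min\<close> in \<open>min_eigenvalue\<close> is an actual eigenvalue.\<close>

lemma min_eigenvalue_eigenvector:
  assumes A: "A \<in> carrier_mat n n" "symmetric_mat A" and n: "n \<ge> 1"
  obtains w where "w \<in> carrier_vec n" "w \<noteq> 0\<^sub>v n" "A *\<^sub>v w = min_eigenvalue A \<cdot>\<^sub>v w"
proof -
  have "spectrum A \<noteq> {}"
    using symmetric_real_eigenvalue_exists[OF A(1)] A(2) n by (auto simp: symmetric_mat_def spectrum_def)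
  then have "min_eigenvalue A \<in> spectrum A"
    unfolding min_eigenvalue_def using card_finite_spectrum(1)[OF A(1)] by (intro Min_in)
  then show ?thesis
    using A(1) that by (auto simp: spectrum_def eigenvalue_def eigenvector_def)
qed

lemma min_eigenvalue_rayleigh:
  assumes A: "A \<in> carrier_mat n n" "symmetric_mat A" and v: "v \<in> carrier_vec n"
  shows "min_eigenvalue A * (v \<bullet> v) \<le> v \<bullet> (A *\<^sub>v v)"
proof -
  obtain U d where U: "orthonormal_mat n U" and Ad: "A = spectral_mat n U d"
    using symmetric_spectralE[OF A] .
  have "min_eigenvalue A \<le> d k" if "k < n" for k
  proof -
    have "eigenvector A (col U k) (d k)"
      using that A(1) spectral_mat_eigenvector[OF U that] col_orthonormal_nonzero[OF U that]
      col_carrier[OF U] by (simp add: eigenvector_def Ad U)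
    then have "d k \<in> spectrum A"
      by (auto simp: spectrum_def eigenvalue_def)
    then show ?thesis
      unfolding min_eigenvalue_def using card_finite_spectrum(1)[OF A(1)] by (intro Min_le)
  qed
  then have "(\<Sum>k<n. min_eigenvalue A * (col U k \<bullet> v)\<^sup>2) \<le> (\<Sum>k<n. d k * (col U k \<bullet> v)\<^sup>2)"
    by (intro sum_mono mult_right_mono) auto
  moreover have "(\<Sum>k<n. min_eigenvalue A * (col U k \<bullet> v)\<^sup>2) = min_eigenvalue A * (v \<bullet> v)"
    using parseval[OF U v] by (simp flip: sum_distrib_left)
  moreover have "(\<Sum>k<n. d k * (col U k \<bullet> v)\<^sup>2) = v \<bullet> (A *\<^sub>v v)"
    by (simp add: Ad spectral_mat_quadratic[OF U v])
  ultimately show ?thesis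
    by simp
qed

text \<open>The product of \<open>M * P\<close> and \<open>M * Q\<close> equals \<open>M * P\<close>
  in one order and \<open>M * Q\<close> in the other. Both factors are symmetric, so transposition
  swaps the orders and forces \<open>M * P = M * Q\<close>; likewise \<open>P * M = Q * M\<close>.
  Then \<open>P = P * M * Q = Q * M * Q = Q\<close>.\<close>

lemma pseudo_inverse_unique:
  assumes P: "is_pseudo_inverse M P" and Q: "is_pseudo_inverse M Q"
  shows "P = Q"
proof -
  have [simp]: "dim_row P = dim_col M" "dim_col P = dim_row M" "dim_row Q = dim_col M" "dim_col Q = dim_row M"
    using P Q by (auto simp: is_pseudo_inverse_def)
  have P1: "M * (P * M) = M" and P2: "P * (M * P) = P" and P3: "transpose_mat (M * P) = M * P" and P4: "transpose_mat (P * M) = P * M"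
    using P by (auto simp: is_pseudo_inverse_def mat_assoc)
  have Q1: "M * (Q * M) = M" and Q2: "Q * (M * Q) = Q" and Q3: "transpose_mat (M * Q) = M * Q" and Q4: "transpose_mat (Q * M) = Q * M"
    using Q by (auto simp: is_pseudo_inverse_def mat_assoc)
  have cancel: "M * (R * (M * X)) = M * X"
    if "M * (R * M) = M" "dim_row R = dim_col M" "dim_col R = dim_row M" "dim_row X = dim_col M" for R X
  proof -
    have "(M * (R * M)) * X = M * (R * (M * X))"
      using that(2-) by (simp add: mat_assoc)
    then show ?thesis
      by (simp add: that(1))
  qed
  have "M * P = (M * Q) * (M * P)"
    by (simp add: mat_assoc cancel[OF Q1])
  also have "\<dots> = transpose_mat ((M * P) * (M * Q))"
    by (simp add: mat_transpose_mult[of "M * P" "M * Q"] P3 Q3)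
  also have "(M * P) * (M * Q) = M * Q"
    by (simp add: mat_assoc cancel[OF P1])
  finally have MP: "M * P = M * Q"
    by (simp add: Q3)
  have "P * M = (P * M) * (Q * M)"
    by (simp add: mat_assoc Q1)
  also have "\<dots> = transpose_mat ((Q * M) * (P * M))"
    by (simp add: mat_transpose_mult[of "Q * M" "P * M"] P4 Q4)
  also have "(Q * M) * (P * M) = Q * M"
    by (simp add: mat_assoc P1)
  finally have PM: "P * M = Q * M"
    by (simp add: Q4)
  have "P = P * M * Q"
    by (simp add: mat_assoc P2 flip: MP)
  also have "\<dots> = Q"
    by (simp add: PM) (simp add: mat_assoc Q2)
  finally show ?thesis .
qed

lemma pseudo_inverse_eqI: "is_pseudo_inverse M P \<Longrightarrow> pseudo_inverse M = P"
  unfolding pseudo_inverse_def using pseudo_inverse_unique by blast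

lemma is_pseudo_inverse_spectral:
  assumes U: "orthonormal_mat n U"
  shows "is_pseudo_inverse (spectral_mat n U d) (spectral_mat n U (\<lambda>i. inverse (d i)))"
proof -
  \<comment> \<open>Since \<open>inverse 0 = 0\<close>, pointwise \<open>inverse\<close> is already
    the scalar pseudoinverse, including on the kernel.\<close>
  have eqs: "d i * inverse (d i) * d i = d i" "inverse (d i) * d i * inverse (d i) = inverse (d i)" for i
    by (cases "d i = 0"; simp)+
  then show ?thesis
    unfolding is_pseudo_inverse_def spectral_mat_mult[OF U] eqs by (simp add: U)
qed

section \<open>Measurability of the pseudoinverse\<close>

lemma pseudo_inverse_spectral:
  "orthonormal_mat n U \<Longrightarrow> pseudo_inverse (spectral_mat n U d) = spectral_mat n U (\<lambda>i. inverse (d i))"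
  by (intro pseudo_inverse_eqI is_pseudo_inverse_spectral)

lemma pseudo_inverse_symmetric:
  assumes "W \<in> carrier_mat q q" "symmetric_mat W"
  shows "is_pseudo_inverse W (pseudo_inverse W)" "symmetric_mat (pseudo_inverse W)"
proof -
  obtain U d where U: "orthonormal_mat q U" and W: "W = spectral_mat q U d"
    using symmetric_spectralE[OF assms] .
  show "is_pseudo_inverse W (pseudo_inverse W)" "symmetric_mat (pseudo_inverse W)"
    using is_pseudo_inverse_spectral[OF U]
    by (simp_all add: W pseudo_inverse_spectral[OF U] symmetric_mat_def U)
qed

text \<open>For symmetric \<open>W\<close> this is gradient descent on the least squares problem,
  started at 0. The step size is 1 over 1 plus the squared Frobenius norm: a rational function of
  the entries that is defined even for \<open>W = 0\<close> and small enough for every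
  eigenvalue.\<close>

primrec landweber :: "real mat \<Rightarrow> nat \<Rightarrow> real mat" where
  "landweber W 0 = 0\<^sub>m (dim_col W) (dim_row W)"
| "landweber W (Suc k) = landweber W k +
     inverse (1 + (\<Sum>i<dim_row W. \<Sum>j<dim_col W. (W $$ (i, j))\<^sup>2)) \<cdot>\<^sub>m (W - W * landweber W k * W)"

text \<open>Cauchy-Schwarz in every row bounds the squared length of \<open>W u\<close> by the
  squared Frobenius norm, and that length is \<open>e\<^sup>2\<close> because \<open>u\<close> is a
  unit vector.\<close>

lemma eigenvalue_le_frobenius:
  fixes W :: "real mat"
  assumes W: "W \<in> carrier_mat q q" and u: "u \<in> carrier_vec q" "u \<bullet> u = 1" and Wu: "W *\<^sub>v u = e \<cdot>\<^sub>v u"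
  shows "e\<^sup>2 \<le> (\<Sum>i<q. \<Sum>j<q. (W $$ (i, j))\<^sup>2)"
proof -
  have u1: "(\<Sum>j<q. (u $ j)\<^sup>2) = 1"
    using u by (simp add: scalar_prod_def power2_eq_square atLeast0LessThan)
  have "e\<^sup>2 = (\<Sum>i<q. (e * u $ i)\<^sup>2)"
    using u1 by (simp add: power_mult_distrib flip: sum_distrib_left)
  also have "\<dots> = (\<Sum>i<q. (\<Sum>j<q. W $$ (i, j) * u $ j)\<^sup>2)"
  proof (rule sum.cong)
    fix i assume "i \<in> {..<q}"
    then have "e * u $ i = (W *\<^sub>v u) $ i"
      using u by (simp add: Wu)
    also have "\<dots> = (\<Sum>j<q. W $$ (i, j) * u $ j)"
      using W u \<open>i \<in> {..<q}\<close> by (auto simp: scalar_prod_def atLeast0LessThan)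
    finally show "(e * u $ i)\<^sup>2 = (\<Sum>j<q. W $$ (i, j) * u $ j)\<^sup>2" by simp
  qed simp
  also have "\<dots> \<le> (\<Sum>i<q. (\<Sum>j<q. (W $$ (i, j))\<^sup>2) * (\<Sum>j<q. (u $ j)\<^sup>2))"
    by (intro sum_mono Cauchy_Schwarz_ineq_sum)
  finally show ?thesis
    by (simp add: u1)
qed

text \<open>In an eigenbasis the recursion decouples into x -> x + w * (d - d * x * d), one copy per
  eigenvalue d. For nonzero d the distance of d * x from 1 shrinks by the factor 1 - w * d^2; for d
  = 0 the iterate stays at 0, the value the pseudoinverse takes there.\<close>

lemma landweber_tendsto_pseudo_inverse:
  assumes W: "W \<in> carrier_mat q q" "symmetric_mat W" and ij: "i < q" "j < q"
  shows "(\<lambda>k. landweber W k $$ (i, j)) \<longlonglongrightarrow> pseudo_inverse W $$ (i, j)"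
proof -
  obtain U d where U: "orthonormal_mat q U" and Wd: "W = spectral_mat q U d"
    using symmetric_spectralE[OF W] .
  define s where "s = (\<Sum>i<q. \<Sum>j<q. (W $$ (i, j))\<^sup>2)"
  \<comment> \<open>Closed form of the scalar recursion started at 0, with step size
    \<open>inverse (1 + s)\<close>.\<close>
  define x where "x k l = inverse (d l) * (1 - (1 - inverse (1 + s) * (d l)\<^sup>2) ^ k)" for k l
  have landweber: "landweber W k = spectral_mat q U (x k)" for k
  proof (induction k)
    case 0
    then show ?case
      by (simp add: Wd x_def U spectral_mat_zero)
  next
    case (Suc k)
    have "landweber W (Suc k) = spectral_mat q U (x k) +
        inverse (1 + s) \<cdot>\<^sub>m (spectral_mat q U d - spectral_mat q U d * spectral_mat q U (x k) * spectral_mat q U d)"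
      by (simp add: Suc s_def) (simp add: Wd U)
    also have "\<dots> = spectral_mat q U (\<lambda>l. x k l + inverse (1 + s) * (d l - d l * x k l * d l))"
      by (simp add: spectral_mat_mult[OF U] spectral_mat_minus[OF U] spectral_mat_smult[OF U] spectral_mat_add[OF U])
    also have "\<dots> = spectral_mat q U (x (Suc k))"
    proof (rule spectral_mat_cong[OF U])
      fix l
      show "x k l + inverse (1 + s) * (d l - d l * x k l * d l) = x (Suc k) l"
      proof (cases "d l = 0")
        case False
        define w p where "w = inverse (1 + s)" and "p = (1 - w * (d l)\<^sup>2) ^ k"
        have eq: "d l * (inverse (d l) * (1 - p)) * d l = (1 - p) * d l"
          "inverse (d l) * (w * (d l)\<^sup>2 * p) = w * p * d l"
          using False by (simp_all add: power2_eq_square)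
        have "inverse (d l) * (1 - p) + w * (d l - d l * (inverse (d l) * (1 - p)) * d l)
            = inverse (d l) * (1 - p) + w * p * d l"
          unfolding eq by (simp add: algebra_simps)
        also have "\<dots> = inverse (d l) * (1 - (1 - w * (d l)\<^sup>2) * p)"
          unfolding eq(2)[symmetric] by (simp only: algebra_simps)
        finally show ?thesis
          unfolding x_def power_Suc w_def[symmetric] p_def[symmetric] .
      qed (simp add: x_def)
    qed
    finally show ?case .
  qed
  have lim: "(\<lambda>k. x k l) \<longlonglongrightarrow> inverse (d l)" if "l < q" for l
  proof (cases "d l = 0")
    case False
    have "(d l)\<^sup>2 \<le> s"
      unfolding s_def
      by (rule eigenvalue_le_frobenius[OF W(1) col_carrier[OF U]])
        (use that spectral_mat_eigenvector[OF U that] col_orthonormal[OF U that that] in \<open>auto simp: Wd\<close>)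
    moreover from this have "1 + s > 0"
      using zero_le_power2[of "d l"] by linarith
    \<comment> \<open>The upper bound is strict because of the 1 added to \<open>s\<close>; the
      ratio of the geometric sequence therefore lies strictly between 0 and 1.\<close>
    ultimately have "0 < inverse (1 + s) * (d l)\<^sup>2" "inverse (1 + s) * (d l)\<^sup>2 < 1"
      using False zero_less_power2[of "d l"] by (auto simp: field_simps dest: order.strict_trans2)
    then have "norm (1 - inverse (1 + s) * (d l)\<^sup>2) < 1"
      unfolding real_norm_def by linarith
    then have "(\<lambda>k. (1 - inverse (1 + s) * (d l)\<^sup>2) ^ k) \<longlonglongrightarrow> 0"
      by (rule LIMSEQ_power_zero)
    then have "(\<lambda>k. x k l) \<longlonglongrightarrow> inverse (d l) * (1 - 0)"
      unfolding x_def by (intro tendsto_mult tendsto_diff tendsto_const)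
    then show ?thesis by simp
  qed (simp add: x_def)
  show ?thesis
    unfolding landweber unfolding Wd pseudo_inverse_spectral[OF U] spectral_mat_index[OF U ij]
    by (intro tendsto_intros lim) auto
qed

section \<open>From the sigma-algebra on samples to measurable matrix-valued maps\<close>

lemma
  shows space_borel_mat: "space (borel_mat m) = {S. dim_row S = m}"
    and orthant_in_borel_mat: "{S \<in> carrier_mat m q. \<forall>i<m. \<forall>j<q. S $$ (i, j) \<le> c i j} \<in> sets (borel_mat m)"
proof -
  have *: "{{S \<in> carrier_mat m q. \<forall>i<m. \<forall>j<q. S $$ (i, j) \<le> c i j} | q c. True} \<subseteq> Pow {S :: real mat. dim_row S = m}"
    by auto
  show "space (borel_mat m) = {S. dim_row S = m}"
    unfolding borel_mat_def using * by (rule space_measure_of)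
  show "{S \<in> carrier_mat m q. \<forall>i<m. \<forall>j<q. S $$ (i, j) \<le> c i j} \<in> sets (borel_mat m)"
    unfolding borel_mat_def sets_measure_of[OF *] by (rule sigma_sets.Basic) blast
qed

text \<open>The bound is a natural number so that sets with unconstrained entries become countable
  unions of orthants.\<close>

lemma real_mat_entries_bounded:
  fixes S :: "real mat"
  shows "\<exists>N :: nat. \<forall>i<m. \<forall>j<q. S $$ (i, j) \<le> real N"
proof -
  have "finite ((\<lambda>p. S $$ p) ` ({..<m} \<times> {..<q}))" by simp
  then obtain b where "\<forall>x \<in> (\<lambda>p. S $$ p) ` ({..<m} \<times> {..<q}). x \<le> b"
    using bdd_above_finite unfolding bdd_above_def by blast
  moreover obtain N :: nat where "b \<le> real N"
    using real_arch_simple by blast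
  ultimately show ?thesis
    by (intro exI[of _ N]) force
qed

lemma carrier_mat_in_borel_mat: "carrier_mat m q \<in> sets (borel_mat m)"
proof -
  have "carrier_mat m q = (\<Union>N::nat. {S \<in> carrier_mat m q. \<forall>i<m. \<forall>j<q. S $$ (i, j) \<le> real N})"
    (is "_ = (\<Union>N. ?O N)")
  proof (intro equalityI subsetI)
    fix S :: "real mat" assume S: "S \<in> carrier_mat m q"
    obtain N :: nat where "\<forall>i<m. \<forall>j<q. S $$ (i, j) \<le> real N"
      using real_mat_entries_bounded[of m q S] by (rule exE)
    with S have "S \<in> ?O N" by simp
    then show "S \<in> (\<Union>N. ?O N)" by (rule UN_I[OF UNIV_I])
  qed (erule UN_E, erule CollectE, erule conjE, assumption)
  also have "\<dots> \<in> sets (borel_mat m)"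
    by (rule sets.countable_UN, rule image_subsetI, rule orthant_in_borel_mat)
  finally show ?thesis .
qed

lemma borel_measurable_mat_entry:
  assumes "i < m" "j < q"
  shows "(\<lambda>S. S $$ (i, j)) \<in> borel_measurable (restrict_space (borel_mat m) (carrier_mat m q))"
proof (rule borel_measurableI_le)
  fix c :: real
  \<comment> \<open>A generator constrains all entries at once. Keeping \<open>c\<close> at the
    chosen position and letting the bound \<open>N\<close> elsewhere grow frees the other
    entries.\<close>
  have "{S \<in> carrier_mat m q. S $$ (i, j) \<le> c} =
      (\<Union>N::nat. {S \<in> carrier_mat m q. \<forall>i'<m. \<forall>j'<q. S $$ (i', j') \<le> (if i' = i \<and> j' = j then c else real N)})"
    (is "_ = (\<Union>N::nat. ?O N)")
  proof (intro equalityI subsetI)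
    fix S assume S: "S \<in> {S \<in> carrier_mat m q. S $$ (i, j) \<le> c}"
    obtain N :: nat where "\<forall>i<m. \<forall>j<q. S $$ (i, j) \<le> real N"
      using real_mat_entries_bounded[of m q S] by (rule exE)
    with S have "S \<in> ?O N" by simp
    then show "S \<in> (\<Union>N. ?O N)" by (rule UN_I[OF UNIV_I])
  next
    fix S assume "S \<in> (\<Union>N. ?O N)"
    then obtain N where N: "S \<in> ?O N" by blast
    then have "S $$ (i, j) \<le> (if i = i \<and> j = j then c else real N)"
      using assms by blast
    with N show "S \<in> {S \<in> carrier_mat m q. S $$ (i, j) \<le> c}" by simp
  qed
  also have "\<dots> \<in> sets (borel_mat m)"
    by (rule sets.countable_UN, rule image_subsetI, rule orthant_in_borel_mat)
  finally have "{S \<in> carrier_mat m q. S $$ (i, j) \<le> c} \<in> sets (borel_mat m)" .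
  moreover have carrier_in_space: "carrier_mat m q \<inter> space (borel_mat m) = carrier_mat m q"
    by (auto simp: space_borel_mat)
  moreover have "{S \<in> space (restrict_space (borel_mat m) (carrier_mat m q)). S $$ (i, j) \<le> c}
      = {S \<in> carrier_mat m q. S $$ (i, j) \<le> c}"
    by (auto simp: space_restrict_space space_borel_mat)
  ultimately show "{S \<in> space (restrict_space (borel_mat m) (carrier_mat m q)). S $$ (i, j) \<le> c}
      \<in> sets (restrict_space (borel_mat m) (carrier_mat m q))"
    using carrier_mat_in_borel_mat[of m q] carrier_in_space
    by (subst sets_restrict_space_iff) auto
qed

text \<open>Measurability is entrywise with a fixed shape: the target needs no sigma-algebra on
  matrices, and closure under matrix operations follows from closure of real measurable functions
  under sums and products.\<close>

definition measurable_mat :: "'a measure \<Rightarrow> nat \<Rightarrow> nat \<Rightarrow> ('a \<Rightarrow> real mat) \<Rightarrow> bool" where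
  "measurable_mat N r c X \<longleftrightarrow> (\<forall>\<omega> \<in> space N. X \<omega> \<in> carrier_mat r c) \<and>
     (\<forall>i<r. \<forall>j<c. (\<lambda>\<omega>. X \<omega> $$ (i, j)) \<in> borel_measurable N)"

lemma measurable_matI:
  assumes "\<And>\<omega>. \<omega> \<in> space N \<Longrightarrow> X \<omega> \<in> carrier_mat r c"
    and "\<And>i j. i < r \<Longrightarrow> j < c \<Longrightarrow> (\<lambda>\<omega>. Y \<omega> i j) \<in> borel_measurable N"
    and "\<And>i j \<omega>. i < r \<Longrightarrow> j < c \<Longrightarrow> \<omega> \<in> space N \<Longrightarrow> X \<omega> $$ (i, j) = Y \<omega> i j"
  shows "measurable_mat N r c X"
  unfolding measurable_mat_def using assms(1)
  by (auto simp: assms(3) intro!: assms(2) measurable_cong[THEN iffD2, OF _ assms(2)])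

lemma measurable_mat_const: "C \<in> carrier_mat r c \<Longrightarrow> measurable_mat N r c (\<lambda>_. C)"
  by (auto simp: measurable_mat_def)

lemma measurable_mat_mult:
  assumes "measurable_mat N r k X" "measurable_mat N k c Y"
  shows "measurable_mat N r c (\<lambda>\<omega>. X \<omega> * Y \<omega>)"
proof (rule measurable_matI[where Y = "\<lambda>\<omega> i j. \<Sum>l<k. X \<omega> $$ (i, l) * Y \<omega> $$ (l, j)"])
  fix \<omega> i j assume "i < r" "j < c" "\<omega> \<in> space N"
  moreover from this assms have "X \<omega> \<in> carrier_mat r k" "Y \<omega> \<in> carrier_mat k c"
    by (auto simp: measurable_mat_def)
  ultimately show "(X \<omega> * Y \<omega>) $$ (i, j) = (\<Sum>l<k. X \<omega> $$ (i, l) * Y \<omega> $$ (l, j))"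
    by (auto simp: scalar_prod_def atLeast0LessThan intro!: sum.cong)
qed (use assms in \<open>auto simp: measurable_mat_def intro!: borel_measurable_sum borel_measurable_times\<close>)

lemma measurable_mat_add:
  assumes "measurable_mat N r c X" "measurable_mat N r c Y"
  shows "measurable_mat N r c (\<lambda>\<omega>. X \<omega> + Y \<omega>)"
proof (rule measurable_matI[where Y = "\<lambda>\<omega> i j. X \<omega> $$ (i, j) + Y \<omega> $$ (i, j)"])
  fix \<omega> i j assume "i < r" "j < c" "\<omega> \<in> space N"
  moreover from this assms have "X \<omega> \<in> carrier_mat r c" "Y \<omega> \<in> carrier_mat r c"
    by (auto simp: measurable_mat_def)
  ultimately show "(X \<omega> + Y \<omega>) $$ (i, j) = X \<omega> $$ (i, j) + Y \<omega> $$ (i, j)"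
    by auto
qed (use assms in \<open>auto simp: measurable_mat_def intro!: borel_measurable_add\<close>)

lemma measurable_mat_minus:
  assumes "measurable_mat N r c X" "measurable_mat N r c Y"
  shows "measurable_mat N r c (\<lambda>\<omega>. X \<omega> - Y \<omega>)"
proof (rule measurable_matI[where Y = "\<lambda>\<omega> i j. X \<omega> $$ (i, j) - Y \<omega> $$ (i, j)"])
  fix \<omega> i j assume "i < r" "j < c" "\<omega> \<in> space N"
  moreover from this assms have "X \<omega> \<in> carrier_mat r c" "Y \<omega> \<in> carrier_mat r c"
    by (auto simp: measurable_mat_def)
  ultimately show "(X \<omega> - Y \<omega>) $$ (i, j) = X \<omega> $$ (i, j) - Y \<omega> $$ (i, j)"
    by auto
qed (use assms in \<open>auto simp: measurable_mat_def intro!: minus_carrier_mat borel_measurable_diff\<close>)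

lemma measurable_mat_smult:
  assumes "f \<in> borel_measurable N" "measurable_mat N r c X"
  shows "measurable_mat N r c (\<lambda>\<omega>. f \<omega> \<cdot>\<^sub>m X \<omega>)"
proof (rule measurable_matI[where Y = "\<lambda>\<omega> i j. f \<omega> * X \<omega> $$ (i, j)"])
  fix \<omega> i j assume "i < r" "j < c" "\<omega> \<in> space N"
  moreover from this assms have "X \<omega> \<in> carrier_mat r c"
    by (auto simp: measurable_mat_def)
  ultimately show "(f \<omega> \<cdot>\<^sub>m X \<omega>) $$ (i, j) = f \<omega> * X \<omega> $$ (i, j)"
    by auto
qed (use assms in \<open>auto simp: measurable_mat_def intro!: borel_measurable_times\<close>)

lemma measurable_mat_transpose:
  assumes "measurable_mat N r c X"
  shows "measurable_mat N c r (\<lambda>\<omega>. transpose_mat (X \<omega>))"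
proof (rule measurable_matI[where Y = "\<lambda>\<omega> i j. X \<omega> $$ (j, i)"])
  fix \<omega> i j assume "i < c" "j < r" "\<omega> \<in> space N"
  moreover from this assms have "X \<omega> \<in> carrier_mat r c"
    by (auto simp: measurable_mat_def)
  ultimately show "transpose_mat (X \<omega>) $$ (i, j) = X \<omega> $$ (j, i)"
    by auto
qed (use assms in \<open>auto simp: measurable_mat_def\<close>)

lemma measurable_mat_landweber:
  assumes W: "measurable_mat N q q W"
  shows "measurable_mat N q q (\<lambda>\<omega>. landweber (W \<omega>) k)"
proof -
  have dims: "dim_row (W \<omega>) = q" "dim_col (W \<omega>) = q" if "\<omega> \<in> space N" for \<omega>
    using W that by (auto simp: measurable_mat_def)
  have cong: "measurable_mat N q q X \<longleftrightarrow> measurable_mat N q q Y"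
    if "\<And>\<omega>. \<omega> \<in> space N \<Longrightarrow> X \<omega> = Y \<omega>" for X Y
    using that by (auto simp: measurable_mat_def cong: measurable_cong)
  have frob: "(\<lambda>\<omega>. inverse (1 + (\<Sum>i<q. \<Sum>j<q. (W \<omega> $$ (i, j))\<^sup>2))) \<in> borel_measurable N"
    using W by (auto simp: measurable_mat_def intro!: borel_measurable_inverse borel_measurable_add
        borel_measurable_sum borel_measurable_power)
  show ?thesis
  proof (induction k)
    case 0
    have "measurable_mat N q q (\<lambda>_. 0\<^sub>m q q)"
      by (intro measurable_mat_const) simp
    then show ?case
      by (subst cong) (auto simp: dims)
  next
    case (Suc k)
    have "measurable_mat N q q (\<lambda>\<omega>. landweber (W \<omega>) k +
        inverse (1 + (\<Sum>i<q. \<Sum>j<q. (W \<omega> $$ (i, j))\<^sup>2)) \<cdot>\<^sub>m (W \<omega> - W \<omega> * landweber (W \<omega>) k * W \<omega>))"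
      by (intro measurable_mat_add measurable_mat_smult measurable_mat_minus measurable_mat_mult[of N q q] Suc frob W)
    then show ?case
      by (subst cong) (auto simp: dims)
  qed
qed

lemma measurable_mat_pseudo_inverse:
  assumes W: "measurable_mat N q q W" and sym: "\<And>\<omega>. \<omega> \<in> space N \<Longrightarrow> symmetric_mat (W \<omega>)"
  shows "measurable_mat N q q (\<lambda>\<omega>. pseudo_inverse (W \<omega>))"
  unfolding measurable_mat_def
proof (intro conjI ballI allI impI)
  fix \<omega> assume "\<omega> \<in> space N"
  moreover from this have "W \<omega> \<in> carrier_mat q q"
    using W by (simp add: measurable_mat_def)
  ultimately show "pseudo_inverse (W \<omega>) \<in> carrier_mat q q"
    using pseudo_inverse_symmetric(1)[OF _ sym] by (auto simp: is_pseudo_inverse_def)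
next
  fix i j assume ij: "i < q" "j < q"
  show "(\<lambda>\<omega>. pseudo_inverse (W \<omega>) $$ (i, j)) \<in> borel_measurable N"
  proof (rule borel_measurable_LIMSEQ_real)
    show "(\<lambda>k. landweber (W \<omega>) k $$ (i, j)) \<longlonglongrightarrow> pseudo_inverse (W \<omega>) $$ (i, j)" if "\<omega> \<in> space N" for \<omega>
      using landweber_tendsto_pseudo_inverse[OF _ sym ij] W that by (simp add: measurable_mat_def)
    show "(\<lambda>\<omega>. landweber (W \<omega>) k $$ (i, j)) \<in> borel_measurable N" for k
      using measurable_mat_landweber[OF W] ij by (simp add: measurable_mat_def)
  qed
qed

section \<open>One step of the method\<close>

text \<open>The double sum separates the products of vector entries from the matrix entries, the
  form in which expectations and independence can be applied term by term.\<close>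

lemma quadratic_form_sum:
  fixes C :: "real mat"
  assumes "C \<in> carrier_mat n n" "v \<in> carrier_vec n"
  shows "v \<bullet> (C *\<^sub>v v) = (\<Sum>i<n. \<Sum>j<n. (v $ i * v $ j) * C $$ (i, j))"
proof -
  have "v \<bullet> (C *\<^sub>v v) = (\<Sum>i<n. v $ i * (\<Sum>j<n. C $$ (i, j) * v $ j))"
    unfolding scalar_prod_def using assms
    by (intro sum.cong) (auto simp: scalar_prod_def atLeast0LessThan)
  then show ?thesis
    by (simp add: sum_distrib_left mult_ac)
qed

lemma pos_def_nonneg:
  assumes "C \<in> carrier_mat n n" "pos_def_mat C" "v \<in> carrier_vec n"
  shows "0 \<le> v \<bullet> (C *\<^sub>v v)"
proof (cases "v = 0\<^sub>v n")
  case True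
  then show ?thesis
    using assms by (simp add: quadratic_form_sum[of C n])
next
  case False
  then show ?thesis
    using assms by (auto simp: pos_def_mat_def intro: less_imp_le)
qed

lemma norm_mat_power2:
  assumes "C \<in> carrier_mat n n" "pos_def_mat C" "v \<in> carrier_vec n"
  shows "(norm_mat C v)\<^sup>2 = v \<bullet> (C *\<^sub>v v)"
  using pos_def_nonneg[OF assms] by (simp add: norm_mat_def)

lemma min_eigenvalue_pos:
  assumes C: "C \<in> carrier_mat n n" "symmetric_mat C" "pos_def_mat C" and n: "n \<ge> 1"
  shows "min_eigenvalue C > 0"
proof -
  obtain w where w: "w \<in> carrier_vec n" "w \<noteq> 0\<^sub>v n" "C *\<^sub>v w = min_eigenvalue C \<cdot>\<^sub>v w"
    using min_eigenvalue_eigenvector[OF C(1,2) n] .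
  have "0 < w \<bullet> (C *\<^sub>v w)"
    using C w(1,2) by (simp add: pos_def_mat_def)
  also have "\<dots> = min_eigenvalue C * (w \<bullet> w)"
    using w by simp
  finally show ?thesis
    using scalar_prod_self_pos[OF w(1,2)] by (simp add: zero_less_mult_iff)
qed

text \<open>Each squared entry is at most \<open>v \<bullet> v\<close>, which the Rayleigh bound
  controls. This turns bounds in the \<open>B\<close>-norm into bounds on entries, as integrability
  requires.\<close>

lemma vec_index_bound_pos_def:
  assumes C: "C \<in> carrier_mat n n" "symmetric_mat C" "pos_def_mat C" and v: "v \<in> carrier_vec n" and i: "i < n"
  shows "(v $ i)\<^sup>2 \<le> (v \<bullet> (C *\<^sub>v v)) / min_eigenvalue C"
proof -
  have "(v $ i)\<^sup>2 \<le> (\<Sum>j<n. (v $ j)\<^sup>2)"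
    using i by (intro member_le_sum) auto
  also have "\<dots> = v \<bullet> v"
    using v by (simp add: scalar_prod_def atLeast0LessThan power2_eq_square)
  also have "\<dots> \<le> (v \<bullet> (C *\<^sub>v v)) / min_eigenvalue C"
    using min_eigenvalue_rayleigh[OF C(1,2) v] min_eigenvalue_pos[OF C] i by (simp add: field_simps)
  finally show ?thesis .
qed

text \<open>With \<open>R = sqrt_mat B\<close>, the substitution \<open>w = R v\<close> turns the
  Rayleigh quotient of the whitened matrix at \<open>w\<close> into the ratio of
  \<open>v \<bullet> (C *\<^sub>v v)\<close> to \<open>v \<bullet> (B *\<^sub>v v)\<close>. Hence
  \<open>l\<close> is the least such ratio, and \<open>CB\<close> caps it at 1.\<close>

lemma whitened_min_eigenvalue:
  assumes B: "B \<in> carrier_mat n n" "symmetric_mat B" "pos_def_mat B"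
    and C: "C \<in> carrier_mat n n" "symmetric_mat C" "pos_def_mat C"
    and CB: "\<And>v. v \<in> carrier_vec n \<Longrightarrow> v \<bullet> (C *\<^sub>v v) \<le> v \<bullet> (B *\<^sub>v v)"
    and n: "n \<ge> 1"
  defines "l \<equiv> min_eigenvalue (inv_mat (sqrt_mat B) * C * inv_mat (sqrt_mat B))"
  shows "0 < l" "l \<le> 1" "\<And>v. v \<in> carrier_vec n \<Longrightarrow> l * (v \<bullet> (B *\<^sub>v v)) \<le> v \<bullet> (C *\<^sub>v v)"
proof -
  define R where "R = sqrt_mat B"
  define Q where "Q = inv_mat R"
  note R = sqrt_mat_pos_def[OF B, folded R_def]
  note Q = pos_def_inv_mat[OF R(1-3), folded Q_def]
  define N where "N = Q * C * Q"
  have l: "l = min_eigenvalue N"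
    by (simp add: l_def N_def Q_def R_def)
  have [simp]: "dim_row R = n" "dim_col R = n" "dim_row Q = n" "dim_col Q = n" "dim_row C = n" "dim_col C = n"
    using R(1) Q(1) C(1) by auto
  have sym: "transpose_mat R = R" "transpose_mat Q = Q" "transpose_mat C = C"
    using R(2) Q(2) C(2) by (simp_all add: symmetric_mat_def)
  have N: "N \<in> carrier_mat n n"
    unfolding N_def by (rule carrier_matI) simp_all
  have Nsym: "symmetric_mat N"
    by (simp add: symmetric_mat_def N_def mat_transpose_mult mat_assoc sym)
  have QN: "w \<bullet> (N *\<^sub>v w) = (Q *\<^sub>v w) \<bullet> (C *\<^sub>v (Q *\<^sub>v w))" if "w \<in> carrier_vec n" for w
    using that by (simp add: N_def mat_vec_assoc scalar_prod_transpose[of Q w] sym)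
  have ww: "(R *\<^sub>v v) \<bullet> (R *\<^sub>v v) = v \<bullet> (B *\<^sub>v v)" if "v \<in> carrier_vec n" for v
    using that by (simp add: mat_vec_assoc scalar_prod_transpose[of R v] sym flip: R(4))
  have QR: "Q *\<^sub>v (R *\<^sub>v v) = v" "R *\<^sub>v (Q *\<^sub>v v) = v" if "v \<in> carrier_vec n" for v
    using that mat_vec_assoc[of Q R v] mat_vec_assoc[of R Q v] Q(4,5) by simp_all
  show "l * (v \<bullet> (B *\<^sub>v v)) \<le> v \<bullet> (C *\<^sub>v v)" if v: "v \<in> carrier_vec n" for v
  proof -
    have Rv: "R *\<^sub>v v \<in> carrier_vec n"
      using R(1) v by (rule mult_mat_vec_carrier)
    show ?thesis
      using min_eigenvalue_rayleigh[OF N Nsym Rv] by (simp add: l ww[OF v] QN[OF Rv] QR[OF v])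
  qed
  \<comment> \<open>The ratio is attained at an eigenvector for \<open>l\<close>: positive
    definiteness of \<open>C\<close> there gives \<open>0 < l\<close>, and comparison with
    \<open>B\<close> gives \<open>l \<le> 1\<close>.\<close>
  obtain w where w: "w \<in> carrier_vec n" "w \<noteq> 0\<^sub>v n" "N *\<^sub>v w = l \<cdot>\<^sub>v w"
    unfolding l using min_eigenvalue_eigenvector[OF N Nsym n] .
  define v where "v = Q *\<^sub>v w"
  have v: "v \<in> carrier_vec n"
    unfolding v_def using Q(1) w(1) by (rule mult_mat_vec_carrier)
  have Rv: "R *\<^sub>v v = w"
    by (simp add: v_def QR w(1))
  have "v \<noteq> 0\<^sub>v n"
  proof
    assume "v = 0\<^sub>v n"
    then have "w = R *\<^sub>v 0\<^sub>v n"
      using Rv by simp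
    also have "\<dots> = 0\<^sub>v n"
      by (rule eq_vecI) (auto simp: scalar_prod_def)
    finally show False
      using w(2) by simp
  qed
  then have "0 < v \<bullet> (C *\<^sub>v v)"
    using C(3) v by (simp add: pos_def_mat_def)
  moreover have eig: "l * (w \<bullet> w) = v \<bullet> (C *\<^sub>v v)"
    using QN[OF w(1)] w by (simp add: v_def)
  ultimately show "0 < l"
    using scalar_prod_self_pos[OF w(1,2)] by (metis zero_less_mult_pos2)
  have "l * (w \<bullet> w) \<le> 1 * (w \<bullet> w)"
    using CB[OF v] ww[OF v] eig Rv by simp
  then show "l \<le> 1"
    using scalar_prod_self_pos[OF w(1,2)] by (rule mult_right_le_imp_le)
qed

section \<open>The deterministic step for a fixed sample\<close>

locale sketched_system =
  fixes m n :: nat and A B :: "real mat"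
  assumes A: "A \<in> carrier_mat m n"
    and B: "B \<in> carrier_mat n n" "symmetric_mat B" "pos_def_mat B"
begin

lemmas inv_B = pos_def_inv_mat[OF B]

lemma A_B_dim [simp]: "dim_row A = m" "dim_col A = n" "dim_row B = n" "dim_col B = n"
    "dim_row (inv_mat B) = n" "dim_col (inv_mat B) = n"
  using A B(1) inv_B(1) by auto

lemma A_B_sym: "transpose_mat B = B" "transpose_mat (inv_mat B) = inv_mat B"
  using B(2) inv_B(2) by (auto simp: symmetric_mat_def)

text \<open>This is the Gram matrix of the columns of \<open>transpose_mat A * S\<close> in the
  inner product of \<open>inv_mat B\<close>. Its symmetry is what makes the spectral description of
  the pseudoinverse applicable.\<close>

lemma sketched_gram:
  assumes "S \<in> carrier_mat m q"
  shows "transpose_mat S * A * inv_mat B * transpose_mat A * S \<in> carrier_mat q q"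
    "symmetric_mat (transpose_mat S * A * inv_mat B * transpose_mat A * S)"
proof -
  have [simp]: "dim_row S = m" "dim_col S = q"
    using assms by auto
  show "transpose_mat S * A * inv_mat B * transpose_mat A * S \<in> carrier_mat q q"
    by (rule carrier_matI) simp_all
  show "symmetric_mat (transpose_mat S * A * inv_mat B * transpose_mat A * S)"
    by (simp add: symmetric_mat_def mat_transpose_mult mat_assoc A_B_sym)
qed

lemma sketch_core_carrier:
  assumes "dim_row S = m"
  shows "sketch_core A B S \<in> carrier_mat m m"
proof -
  have "S \<in> carrier_mat m (dim_col S)"
    using assms by auto
  note P = pseudo_inverse_symmetric(1)[OF sketched_gram[OF this]]
  show ?thesis
    unfolding sketch_core_def using assms P by (intro carrier_matI) (auto simp: is_pseudo_inverse_def)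
qed

lemma Z_mat_props:
  assumes S: "dim_row S = m"
  shows "Z_mat A B S \<in> carrier_mat n n" "transpose_mat (Z_mat A B S) = Z_mat A B S"
    "Z_mat A B S * (inv_mat B * Z_mat A B S) = Z_mat A B S"
proof -
  define W where "W = transpose_mat S * A * inv_mat B * transpose_mat A * S"
  have Sc: "S \<in> carrier_mat m (dim_col S)"
    using S by auto
  note W = sketched_gram[OF Sc, folded W_def]
  define P where "P = pseudo_inverse W"
  note P = pseudo_inverse_symmetric[OF W, folded P_def]
  have [simp]: "dim_row P = dim_col S" "dim_col P = dim_col S" "dim_row W = dim_col S" "dim_col W = dim_col S"
    using P(1) W(1) by (auto simp: is_pseudo_inverse_def)
  have Z: "Z_mat A B S = transpose_mat A * (S * P * transpose_mat S) * A"
    by (simp add: Z_mat_def sketch_core_def P_def W_def)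
  show "Z_mat A B S \<in> carrier_mat n n"
    unfolding Z by (rule carrier_matI) simp_all
  have "transpose_mat P = P"
    using P(2) by (simp add: symmetric_mat_def)
  then show "transpose_mat (Z_mat A B S) = Z_mat A B S"
    by (simp add: Z mat_transpose_mult mat_assoc S)
  \<comment> \<open>The identity \<open>P * W * P = P\<close> with a trailing factor
    \<open>X\<close>, in the right-nested form into which \<open>mat_assoc\<close> rewrites
    products.\<close>
  have PWP: "P * (transpose_mat S * (A * (inv_mat B * (transpose_mat A * (S * (P * X)))))) = P * X"
    if "dim_row X = dim_col S" for X
  proof -
    have "P * X = (P * W * P) * X"
      using P(1) by (simp add: is_pseudo_inverse_def)
    also have "\<dots> = P * (transpose_mat S * (A * (inv_mat B * (transpose_mat A * (S * (P * X))))))"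
      using that by (simp add: W_def mat_assoc S)
    finally show ?thesis ..
  qed
  show "Z_mat A B S * (inv_mat B * Z_mat A B S) = Z_mat A B S"
    by (simp add: Z mat_assoc S PWP)
qed

text \<open>Pythagoras: \<open>u = inv_mat B *\<^sub>v z\<close> is the part of \<open>v\<close>
  removed by the projection, and both \<open>u \<bullet> (B *\<^sub>v u)\<close> and
  \<open>u \<bullet> (B *\<^sub>v v)\<close> equal \<open>v \<bullet> z\<close>. The two
  inequalities say that \<open>u\<close> and the remaining part \<open>e\<close> have nonnegative
  squared \<open>B\<close>-norms.\<close>

lemma Z_mat_step:
  assumes S: "dim_row S = m" and v: "v \<in> carrier_vec n"
  defines "e \<equiv> v - (inv_mat B * Z_mat A B S) *\<^sub>v v"
  shows "e \<bullet> (B *\<^sub>v e) = v \<bullet> (B *\<^sub>v v) - v \<bullet> (Z_mat A B S *\<^sub>v v)"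
    and "0 \<le> v \<bullet> (Z_mat A B S *\<^sub>v v)" and "v \<bullet> (Z_mat A B S *\<^sub>v v) \<le> v \<bullet> (B *\<^sub>v v)"
proof -
  define Z where "Z = Z_mat A B S"
  note Z = Z_mat_props[OF S, folded Z_def]
  have [simp]: "dim_row Z = n" "dim_col Z = n" "dim_vec v = n"
    using Z(1) v by auto
  define z where "z = Z *\<^sub>v v"
  have z: "z \<in> carrier_vec n"
    unfolding z_def using Z(1) v by (rule mult_mat_vec_carrier)
  define u where "u = inv_mat B *\<^sub>v z"
  have u: "u \<in> carrier_vec n"
    unfolding u_def using inv_B(1) z by (rule mult_mat_vec_carrier)
  have [simp]: "dim_vec z = n" "dim_vec u = n"
    using z u by auto
  have Bu: "B *\<^sub>v u = z"
    using mat_vec_assoc[of B "inv_mat B" z] z inv_B(4) by (simp add: u_def)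
  have e: "e = v - u"
    by (simp add: e_def u_def z_def mat_vec_assoc flip: Z_def)
  have ec: "e \<in> carrier_vec n"
    unfolding e using v u by simp
  have Bv: "B *\<^sub>v v \<in> carrier_vec n"
    using B(1) v by (rule mult_mat_vec_carrier)
  have uz: "u \<bullet> z = v \<bullet> z"
  proof -
    have "v \<bullet> z = v \<bullet> ((Z * (inv_mat B * Z)) *\<^sub>v v)"
      by (simp add: Z(3) z_def)
    also have "\<dots> = v \<bullet> (Z *\<^sub>v u)"
      by (simp add: mat_vec_assoc u_def z_def)
    also have "\<dots> = z \<bullet> u"
      by (simp add: scalar_prod_transpose[of Z v u] Z(2) z_def)
    also have "\<dots> = u \<bullet> z"
      using z u by (rule comm_scalar_prod)
    finally show ?thesis ..
  qed
  have uBv: "u \<bullet> (B *\<^sub>v v) = v \<bullet> z"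
    using comm_scalar_prod[OF z v] by (simp add: scalar_prod_transpose[of B u v] A_B_sym Bu)
  have "B *\<^sub>v e = B *\<^sub>v v - z"
    unfolding e using mult_minus_distrib_mat_vec[OF B(1) v u] by (simp add: Bu)
  then have "e \<bullet> (B *\<^sub>v e) = v \<bullet> (B *\<^sub>v v) - v \<bullet> z - (u \<bullet> (B *\<^sub>v v) - u \<bullet> z)"
    using v u z Bv by (simp add: e minus_scalar_prod_distrib[of _ n] scalar_prod_minus_distrib[of _ n])
  then show eq: "e \<bullet> (B *\<^sub>v e) = v \<bullet> (B *\<^sub>v v) - v \<bullet> (Z_mat A B S *\<^sub>v v)"
    by (simp add: uz uBv flip: Z_def z_def)
  have "0 \<le> u \<bullet> (B *\<^sub>v u)"
    using pos_def_nonneg[OF B(1,3) u] .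
  then show "0 \<le> v \<bullet> (Z_mat A B S *\<^sub>v v)"
    by (simp add: Bu uz flip: Z_def z_def)
  show "v \<bullet> (Z_mat A B S *\<^sub>v v) \<le> v \<bullet> (B *\<^sub>v v)"
    using pos_def_nonneg[OF B(1,3) ec] eq by simp
qed

text \<open>Diagonal entries lie between 0 and those of \<open>B\<close>, and polarisation with the
  sum \<open>u\<close> of two unit vectors recovers the other entries. The bound \<open>K\<close>
  involves only \<open>B\<close>, so it is uniform over all samples and all numbers of
  columns.\<close>

lemma Z_mat_bounded:
  assumes ij: "i < n" "j < n"
  shows "\<exists>K. \<forall>S. dim_row S = m \<longrightarrow> \<bar>Z_mat A B S $$ (i, j)\<bar> \<le> K"
proof -
  define u where "u = unit_vec n i + (unit_vec n j :: real vec)"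
  have u: "u \<in> carrier_vec n"
    by (simp add: u_def)
  have diag: "unit_vec n k \<bullet> (C *\<^sub>v unit_vec n l) = C $$ (k, l)"
    if "k < n" "l < n" "C \<in> carrier_mat n n" for k l and C :: "real mat"
    using that by simp
  define K where "K = B $$ (i, i) + B $$ (j, j) + u \<bullet> (B *\<^sub>v u)"
  have "\<bar>Z_mat A B S $$ (i, j)\<bar> \<le> K" if S: "dim_row S = m" for S
  proof -
    define Z where "Z = Z_mat A B S"
    note Z = Z_mat_props[OF S, folded Z_def]
    note step = Z_mat_step[OF S, folded Z_def]
    have dims [simp]: "dim_row Z = n" "dim_col Z = n"
      using Z(1) by auto
    have Zji: "Z $$ (j, i) = Z $$ (i, j)"
      using arg_cong[OF Z(2), of "\<lambda>C. C $$ (i, j)"] ij by simp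
    have bd: "0 \<le> Z $$ (k, k)" "Z $$ (k, k) \<le> B $$ (k, k)" if "k < n" for k
      using step(2,3)[of "unit_vec n k"] diag[OF that that Z(1)] diag[OF that that B(1)] by simp_all
    have uc: "Z *\<^sub>v unit_vec n k \<in> carrier_vec n" for k
      using Z(1) unit_vec_carrier by (rule mult_mat_vec_carrier)
    have "Z *\<^sub>v u = Z *\<^sub>v unit_vec n i + Z *\<^sub>v unit_vec n j"
      unfolding u_def using Z(1) by (rule mult_add_distrib_mat_vec) simp_all
    then have "u \<bullet> (Z *\<^sub>v u) = Z $$ (i, i) + Z $$ (j, i) + (Z $$ (i, j) + Z $$ (j, j))"
      using ij diag[OF _ _ Z(1)] uc unfolding u_def
      by (simp add: scalar_prod_add_distrib[of _ n] add_scalar_prod_distrib[of _ n] del: scalar_prod_left_unit)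
    then have "2 * Z $$ (i, j) = u \<bullet> (Z *\<^sub>v u) - Z $$ (i, i) - Z $$ (j, j)"
      by (simp add: Zji)
    then show ?thesis
      unfolding K_def Z_def[symmetric]
      using bd[OF ij(1)] bd[OF ij(2)] step(2)[OF u] step(3)[OF u] by (simp add: abs_le_iff)
  qed
  then show ?thesis by blast
qed

lemma measurable_Z_mat: "measurable_mat (borel_mat m) n n (Z_mat A B)"
proof -
  have "measurable_mat (restrict_space (borel_mat m) (carrier_mat m q)) n n (Z_mat A B)" (is "measurable_mat ?N n n _") for q
  proof -
    have space: "space ?N = carrier_mat m q"
      by (auto simp: space_restrict_space space_borel_mat)
    have S: "measurable_mat ?N m q (\<lambda>S. S)"
      by (simp add: measurable_mat_def space borel_measurable_mat_entry)
    note const_mats = measurable_mat_const[OF A] measurable_mat_const[OF inv_B(1)]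
      measurable_mat_const[OF transpose_carrier_mat[THEN iffD2, OF A]]
    have "measurable_mat ?N q q (\<lambda>S. transpose_mat S * A * inv_mat B * transpose_mat A * S)"
      by (rule measurable_mat_mult measurable_mat_transpose S const_mats)+
    then have P: "measurable_mat ?N q q (\<lambda>S. pseudo_inverse (transpose_mat S * A * inv_mat B * transpose_mat A * S))"
      by (rule measurable_mat_pseudo_inverse) (use sketched_gram(2) in \<open>simp add: space\<close>)
    show ?thesis
      unfolding Z_mat_def sketch_core_def
      by (rule measurable_mat_mult measurable_mat_transpose S const_mats P)+
  qed
  note * = this
  have "(\<lambda>S. Z_mat A B S $$ (i, j)) \<in> borel_measurable (borel_mat m)" if "i < n" "j < n" for i j
  \<comment> \<open>The pieces \<open>carrier_mat m q\<close> are measurable and countably many; on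
    each one the pseudoinverse has a fixed size.\<close>
  proof (rule measurable_piecewise_restrict[of "range (carrier_mat m)"])
    show "space (borel_mat m) \<subseteq> \<Union> (range (carrier_mat m))"
      by (auto simp: space_borel_mat)
    fix \<Omega> :: "real mat set" assume "\<Omega> \<in> range (carrier_mat m)"
    then obtain q where q: "\<Omega> = carrier_mat m q" by blast
    show "\<Omega> \<inter> space (borel_mat m) \<in> sets (borel_mat m)"
      unfolding q using carrier_mat_in_borel_mat[of m q] by (rule sets.Int) simp
    show "(\<lambda>S. Z_mat A B S $$ (i, j)) \<in> borel_measurable (restrict_space (borel_mat m) \<Omega>)"
      unfolding q using *[of q] that by (simp add: measurable_mat_def)
  qed simp
  then show ?thesis
    by (simp add: measurable_mat_def space_borel_mat Z_mat_props(1))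
qed

end

section \<open>The random iteration\<close>

lemma
  fixes F :: "nat \<Rightarrow> nat \<Rightarrow> 'a \<Rightarrow> real"
  assumes F: "\<And>i j. i < n \<Longrightarrow> j < n \<Longrightarrow> integrable M (F i j)"
  shows integrable_double_sum: "integrable M (\<lambda>\<omega>. \<Sum>i<n. \<Sum>j<n. F i j \<omega>)"
    and integral_double_sum: "(\<integral>\<omega>. (\<Sum>i<n. \<Sum>j<n. F i j \<omega>) \<partial>M) = (\<Sum>i<n. \<Sum>j<n. \<integral>\<omega>. F i j \<omega> \<partial>M)"
proof -
  have row: "integrable M (\<lambda>\<omega>. \<Sum>j<n. F i j \<omega>)" if "i < n" for i
    by (rule Bochner_Integration.integrable_sum) (use F that in auto)
  then show "integrable M (\<lambda>\<omega>. \<Sum>i<n. \<Sum>j<n. F i j \<omega>)"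
    by (rule Bochner_Integration.integrable_sum) auto
  show "(\<integral>\<omega>. (\<Sum>i<n. \<Sum>j<n. F i j \<omega>) \<partial>M) = (\<Sum>i<n. \<Sum>j<n. \<integral>\<omega>. F i j \<omega> \<partial>M)"
    by (subst Bochner_Integration.integral_sum[OF row])
      (auto intro!: sum.cong Bochner_Integration.integral_sum F)
qed

locale randomized_iteration = sketched_system m n A B + prob_space M
  for m n :: nat and A B :: "real mat" and M :: "'a measure" +
  fixes b x0 xstar :: "real vec" and S :: "'a \<Rightarrow> real mat" and Sk :: "nat \<Rightarrow> 'a \<Rightarrow> real mat"
  assumes xstar: "xstar \<in> carrier_vec n" "A *\<^sub>v xstar = b"
    and x0: "x0 \<in> carrier_vec n"
    and S: "S \<in> measurable M (borel_mat m)"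
    and indep: "indep_vars (\<lambda>_. borel_mat m) Sk UNIV"
    and copies: "\<And>k. distr M (borel_mat m) (Sk k) = distr M (borel_mat m) S"
begin

text \<open>A deterministic function of the whole sample sequence \<open>s\<close>. Keeping the
  randomness out permits pathwise bounds and measurability on product spaces.\<close>

definition error :: "(nat \<Rightarrow> real mat) \<Rightarrow> nat \<Rightarrow> real vec" where
  "error s k = iterate A B b s x0 k - xstar"

lemma iterate_carrier: "iterate A B b s x0 k \<in> carrier_vec n"
proof (cases k)
  case (Suc j)
  then show ?thesis
    by (intro carrier_vecI) (simp add: Let_def)
qed (simp add: x0)

lemma error_carrier: "error s k \<in> carrier_vec n"
  unfolding error_def using iterate_carrier xstar(1) by (rule minus_carrier_vec)

lemma error_cong:
  assumes "\<And>i. i < k \<Longrightarrow> s i = s' i"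
  shows "error s k = error s' k"
proof -
  have "iterate A B b s x0 k = iterate A B b s' x0 k"
    using assms by (induction k) (simp_all add: Let_def)
  then show ?thesis
    by (simp add: error_def)
qed

text \<open>Consistency enters here: \<open>A *\<^sub>v xstar = b\<close> turns the residual into
  \<open>A\<close> applied to the error.\<close>

lemma error_Suc:
  assumes "dim_row (s k) = m"
  shows "error s (Suc k) = error s k - (inv_mat B * Z_mat A B (s k)) *\<^sub>v error s k"
proof -
  define x where "x = iterate A B b s x0 k"
  define Y where "Y = sketch_core A B (s k)"
  have x: "x \<in> carrier_vec n"
    unfolding x_def by (rule iterate_carrier)
  have [simp]: "dim_row Y = m" "dim_col Y = m" "dim_vec x = n" "dim_vec xstar = n"
    using sketch_core_carrier[OF assms] x xstar(1) by (auto simp: Y_def)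
  have r: "A *\<^sub>v x - b = A *\<^sub>v (x - xstar)"
    using mult_minus_distrib_mat_vec[OF A x xstar(1)] by (simp add: xstar(2))
  have y: "(inv_mat B * transpose_mat A * Y) *\<^sub>v (A *\<^sub>v (x - xstar))
      = (inv_mat B * (transpose_mat A * Y * A)) *\<^sub>v (x - xstar)"
    by (simp add: mat_vec_assoc)
  have swap: "x - w - xstar = x - xstar - w" if "dim_vec w = n" for w
    using that by (intro eq_vecI) auto
  have "error s (Suc k) = x - (inv_mat B * transpose_mat A * Y) *\<^sub>v (A *\<^sub>v x - b) - xstar"
    by (simp add: error_def Let_def flip: x_def Y_def)
  also have "\<dots> = x - xstar - (inv_mat B * (transpose_mat A * Y * A)) *\<^sub>v (x - xstar)"
    unfolding r y by (rule swap) simp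
  finally show ?thesis
    by (simp add: error_def Z_mat_def flip: x_def Y_def)
qed

lemma error_norm_Suc:
  assumes "dim_row (s k) = m"
  shows "error s (Suc k) \<bullet> (B *\<^sub>v error s (Suc k)) =
    error s k \<bullet> (B *\<^sub>v error s k) - error s k \<bullet> (Z_mat A B (s k) *\<^sub>v error s k)"
  unfolding error_Suc[where s = s, OF assms] by (rule Z_mat_step(1)[OF assms error_carrier])

lemma error_norm_le:
  assumes "\<And>i. dim_row (s i) = m"
  shows "error s k \<bullet> (B *\<^sub>v error s k) \<le> (x0 - xstar) \<bullet> (B *\<^sub>v (x0 - xstar))"
proof (induction k)
  case (Suc k)
  then show ?case
    using error_norm_Suc[where s = s and k = k, OF assms] Z_mat_step(2)[OF assms[of k] error_carrier[of s k]]
    by linarith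
qed (simp add: error_def)

text \<open>Since no step increases the \<open>B\<close>-norm, the initial error bounds all later
  ones along every sample path; the resulting constant is deterministic.\<close>

lemma error_bounded: "\<exists>K. \<forall>s i. (\<forall>j. dim_row (s j) = m) \<longrightarrow> i < n \<longrightarrow> \<bar>error s k $ i\<bar> \<le> K"
proof (intro exI allI impI)
  fix s :: "nat \<Rightarrow> real mat" and i
  assume s: "\<forall>j. dim_row (s j) = m" and i: "i < n"
  have "(error s k $ i)\<^sup>2 \<le> (error s k \<bullet> (B *\<^sub>v error s k)) / min_eigenvalue B"
    by (rule vec_index_bound_pos_def[OF B error_carrier i])
  also have "\<dots> \<le> ((x0 - xstar) \<bullet> (B *\<^sub>v (x0 - xstar))) / min_eigenvalue B"
    using error_norm_le[of s k] s min_eigenvalue_pos[OF B] i by (intro divide_right_mono) simp_all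
  finally show "\<bar>error s k $ i\<bar> \<le> sqrt (((x0 - xstar) \<bullet> (B *\<^sub>v (x0 - xstar))) / min_eigenvalue B)"
    by (intro real_le_rsqrt) simp
qed

text \<open>The index set \<open>J\<close> is left open because two instances are needed: all of
  \<open>UNIV\<close> for measurability on \<open>M\<close>, and \<open>{..<k}\<close> to separate
  the past from the current sample.\<close>

lemma measurable_error:
  assumes "{..<k} \<subseteq> J" "i < n"
  shows "(\<lambda>s. error s k $ i) \<in> borel_measurable (Pi\<^sub>M J (\<lambda>_. borel_mat m))"
  using assms
proof (induction k arbitrary: i)
  case 0
  then show ?case by (simp add: error_def)
next
  case (Suc k)
  then have k: "k \<in> J" and sub: "{..<k} \<subseteq> J" by auto
  have comp: "(\<lambda>s. s k) \<in> measurable (Pi\<^sub>M J (\<lambda>_. borel_mat m)) (borel_mat m)"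
    using k by (rule measurable_component_singleton)
  have "measurable_mat (borel_mat m) n n (\<lambda>Y. inv_mat B * Z_mat A B Y)"
    by (rule measurable_mat_mult[OF measurable_mat_const[OF inv_B(1)] measurable_Z_mat])
  then have IZ: "(\<lambda>s. (inv_mat B * Z_mat A B (s k)) $$ (i, j)) \<in> borel_measurable (Pi\<^sub>M J (\<lambda>_. borel_mat m))"
    if "j < n" for j
  proof -
    have "(\<lambda>Y. (inv_mat B * Z_mat A B Y) $$ (i, j)) \<in> borel_measurable (borel_mat m)"
      using \<open>measurable_mat (borel_mat m) n n (\<lambda>Y. inv_mat B * Z_mat A B Y)\<close> Suc.prems(2) that
      by (simp add: measurable_mat_def)
    then show ?thesis
      by (rule measurable_compose[OF comp])
  qed
  have "(\<lambda>s. error s k $ i - (\<Sum>j<n. (inv_mat B * Z_mat A B (s k)) $$ (i, j) * error s k $ j))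
      \<in> borel_measurable (Pi\<^sub>M J (\<lambda>_. borel_mat m))"
    using Suc.prems(2) by (intro borel_measurable_diff borel_measurable_sum borel_measurable_times IZ Suc.IH[OF sub]) auto
  moreover have "error s (Suc k) $ i
      = error s k $ i - (\<Sum>j<n. (inv_mat B * Z_mat A B (s k)) $$ (i, j) * error s k $ j)"
    if "s \<in> space (Pi\<^sub>M J (\<lambda>_. borel_mat m))" for s
  proof -
    have d: "dim_row (s k) = m"
      using measurable_space[OF comp that] by (simp add: space_borel_mat)
    have [simp]: "dim_row (Z_mat A B (s k)) = n" "dim_col (Z_mat A B (s k)) = n" "dim_vec (error s k) = n"
      using Z_mat_props(1)[OF d] error_carrier[of s k] by auto
    show ?thesis
      unfolding error_Suc[where s = s, OF d] using Suc.prems(2)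
      by (simp add: scalar_prod_def[of _ "error s k"] atLeast0LessThan)
  qed
  ultimately show ?case
    by (subst measurable_cong) auto
qed

section \<open>Moments and independence of the random error\<close>

lemma measurable_Sk: "Sk k \<in> measurable M (borel_mat m)"
  using indep by (auto simp: indep_vars_def)

lemma dim_row_Sk: "\<omega> \<in> space M \<Longrightarrow> dim_row (Sk k \<omega>) = m"
  using measurable_space[OF measurable_Sk] by (simp add: space_borel_mat)

lemma dim_row_S: "\<omega> \<in> space M \<Longrightarrow> dim_row (S \<omega>) = m"
  using measurable_space[OF S] by (simp add: space_borel_mat)

definition err :: "nat \<Rightarrow> 'a \<Rightarrow> real vec" where
  "err k \<omega> = error (\<lambda>i. Sk i \<omega>) k"

lemma err_carrier: "err k \<omega> \<in> carrier_vec n"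
  by (simp add: err_def error_carrier)

lemma measurable_err: "i < n \<Longrightarrow> (\<lambda>\<omega>. err k \<omega> $ i) \<in> borel_measurable M"
proof -
  assume i: "i < n"
  have "(\<lambda>\<omega>. \<lambda>i\<in>UNIV. Sk i \<omega>) \<in> measurable M (Pi\<^sub>M UNIV (\<lambda>_. borel_mat m))"
    by (rule measurable_restrict) (rule measurable_Sk)
  from measurable_compose[OF this measurable_error[OF subset_UNIV i]]
  show ?thesis
    by (simp add: err_def restrict_def)
qed

lemma integrable_err_prod:
  assumes "i < n" "j < n"
  shows "integrable M (\<lambda>\<omega>. err k \<omega> $ i * err k \<omega> $ j)"
proof -
  obtain K where K: "\<And>s i. (\<forall>j. dim_row (s j) = m) \<Longrightarrow> i < n \<Longrightarrow> \<bar>error s k $ i\<bar> \<le> K"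
    using error_bounded by blast
  have "\<bar>err k \<omega> $ i * err k \<omega> $ j\<bar> \<le> K * K" if "\<omega> \<in> space M" for \<omega>
  proof -
    have "\<bar>err k \<omega> $ i\<bar> \<le> K" "\<bar>err k \<omega> $ j\<bar> \<le> K"
      unfolding err_def using that assms by (auto intro!: K simp: dim_row_Sk)
    then show ?thesis
      unfolding abs_mult by (intro mult_mono) auto
  qed
  then show ?thesis
    using measurable_err assms by (intro integrable_const_bound[of _ "K * K"] AE_I2 borel_measurable_times) auto
qed

lemma integrable_Z_mat:
  assumes ij: "i < n" "j < n" and X: "X \<in> measurable M (borel_mat m)"
  shows "integrable M (\<lambda>\<omega>. Z_mat A B (X \<omega>) $$ (i, j))"
proof -
  obtain K where K: "\<And>Y. dim_row Y = m \<Longrightarrow> \<bar>Z_mat A B Y $$ (i, j)\<bar> \<le> K"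
    using Z_mat_bounded[OF ij] by blast
  have "(\<lambda>Y. Z_mat A B Y $$ (i, j)) \<in> borel_measurable (borel_mat m)"
    using measurable_Z_mat ij by (simp add: measurable_mat_def)
  from measurable_compose[OF X this] show ?thesis
    using measurable_space[OF X] K
    by (intro integrable_const_bound[of _ K] AE_I2) (auto simp: space_borel_mat)
qed

definition EZ :: "real mat" where
  "EZ = expectation_mat M n n (\<lambda>\<omega>. Z_mat A B (S \<omega>))"

lemma EZ_carrier: "EZ \<in> carrier_mat n n"
  by (simp add: EZ_def expectation_mat_def)

lemma EZ_index: "i < n \<Longrightarrow> j < n \<Longrightarrow> EZ $$ (i, j) = (\<integral>\<omega>. Z_mat A B (S \<omega>) $$ (i, j) \<partial>M)"
  by (simp add: EZ_def expectation_mat_def)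

text \<open>The expectation depends only on the law of the sample, so the equality of distributions
  in \<open>copies\<close> moves it from \<open>S\<close> to \<open>Sk k\<close>.\<close>

lemma EZ_Sk: "i < n \<Longrightarrow> j < n \<Longrightarrow> EZ $$ (i, j) = (\<integral>\<omega>. Z_mat A B (Sk k \<omega>) $$ (i, j) \<partial>M)"
proof -
  assume ij: "i < n" "j < n"
  then have *: "(\<lambda>Y. Z_mat A B Y $$ (i, j)) \<in> borel_measurable (borel_mat m)"
    using measurable_Z_mat by (simp add: measurable_mat_def)
  show ?thesis
    using integral_distr[OF S *] integral_distr[OF measurable_Sk *, of k] ij by (simp add: EZ_index copies)
qed

lemma EZ_symmetric: "symmetric_mat EZ"
proof -
  have "(\<integral>\<omega>. Z_mat A B (S \<omega>) $$ (j, i) \<partial>M) = (\<integral>\<omega>. Z_mat A B (S \<omega>) $$ (i, j) \<partial>M)"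
    if "i < n" "j < n" for i j
  proof (rule Bochner_Integration.integral_cong)
    fix \<omega> assume "\<omega> \<in> space M"
    note Z = Z_mat_props(1,2)[OF dim_row_S[OF this]]
    show "Z_mat A B (S \<omega>) $$ (j, i) = Z_mat A B (S \<omega>) $$ (i, j)"
      using arg_cong[OF Z(2), of "\<lambda>C. C $$ (i, j)"] Z(1) that by auto
  qed simp
  then show ?thesis
    unfolding symmetric_mat_def using EZ_carrier by (intro eq_matI) (auto simp: EZ_index)
qed

text \<open>The pointwise bound of \<open>Z\<close> by \<open>B\<close> survives averaging; it is
  what later keeps the contraction factor nonnegative.\<close>

lemma EZ_le_B:
  assumes v: "v \<in> carrier_vec n"
  shows "v \<bullet> (EZ *\<^sub>v v) \<le> v \<bullet> (B *\<^sub>v v)"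
proof -
  have int: "integrable M (\<lambda>\<omega>. v $ i * v $ j * Z_mat A B (S \<omega>) $$ (i, j))" if "i < n" "j < n" for i j
    by (intro integrable_mult_right integrable_Z_mat that S)
  have "v \<bullet> (EZ *\<^sub>v v) = (\<Sum>i<n. \<Sum>j<n. \<integral>\<omega>. v $ i * v $ j * Z_mat A B (S \<omega>) $$ (i, j) \<partial>M)"
    by (simp add: quadratic_form_sum[OF EZ_carrier v] EZ_index)
  also have "\<dots> = (\<integral>\<omega>. (\<Sum>i<n. \<Sum>j<n. v $ i * v $ j * Z_mat A B (S \<omega>) $$ (i, j)) \<partial>M)"
    using int by (rule integral_double_sum[symmetric])
  also have "\<dots> \<le> (\<integral>\<omega>. v \<bullet> (B *\<^sub>v v) \<partial>M)"
  proof (rule integral_mono)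
    show "integrable M (\<lambda>\<omega>. \<Sum>i<n. \<Sum>j<n. v $ i * v $ j * Z_mat A B (S \<omega>) $$ (i, j))"
      using int by (rule integrable_double_sum)
    fix \<omega> assume "\<omega> \<in> space M"
    note d = dim_row_S[OF this]
    show "(\<Sum>i<n. \<Sum>j<n. v $ i * v $ j * Z_mat A B (S \<omega>) $$ (i, j)) \<le> v \<bullet> (B *\<^sub>v v)"
      using Z_mat_step(3)[OF d v] by (simp add: quadratic_form_sum[OF Z_mat_props(1)[OF d] v])
  qed simp
  finally show ?thesis
    by (simp add: prob_space)
qed

lemma
  assumes C: "C \<in> carrier_mat n n"
  shows integrable_err_quadratic: "integrable M (\<lambda>\<omega>. err k \<omega> \<bullet> (C *\<^sub>v err k \<omega>))"
    and integral_err_quadratic: "(\<integral>\<omega>. err k \<omega> \<bullet> (C *\<^sub>v err k \<omega>) \<partial>M)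
      = (\<Sum>i<n. \<Sum>j<n. (\<integral>\<omega>. err k \<omega> $ i * err k \<omega> $ j \<partial>M) * C $$ (i, j))"
proof -
  have int: "integrable M (\<lambda>\<omega>. err k \<omega> $ i * err k \<omega> $ j * C $$ (i, j))" if "i < n" "j < n" for i j
    by (intro integrable_mult_left integrable_err_prod that)
  show "integrable M (\<lambda>\<omega>. err k \<omega> \<bullet> (C *\<^sub>v err k \<omega>))"
    unfolding quadratic_form_sum[OF C err_carrier] using int by (rule integrable_double_sum)
  show "(\<integral>\<omega>. err k \<omega> \<bullet> (C *\<^sub>v err k \<omega>) \<partial>M)
      = (\<Sum>i<n. \<Sum>j<n. (\<integral>\<omega>. err k \<omega> $ i * err k \<omega> $ j \<partial>M) * C $$ (i, j))"
    unfolding quadratic_form_sum[OF C err_carrier] by (subst integral_double_sum[OF int]) simp_all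
qed

text \<open>The error after \<open>k\<close> steps depends on the first \<open>k\<close> samples only and is therefore
  independent of the sample drawn in step \<open>k\<close>.\<close>

lemma
  assumes ij: "i < n" "j < n"
  shows integrable_err_Z: "integrable M (\<lambda>\<omega>. (err k \<omega> $ i * err k \<omega> $ j) * Z_mat A B (Sk k \<omega>) $$ (i, j))" (is ?int)
    and integral_err_Z: "(\<integral>\<omega>. (err k \<omega> $ i * err k \<omega> $ j) * Z_mat A B (Sk k \<omega>) $$ (i, j) \<partial>M)
      = (\<integral>\<omega>. err k \<omega> $ i * err k \<omega> $ j \<partial>M) * EZ $$ (i, j)" (is ?eq)
proof -
  define f where "f = (\<lambda>s. error s k $ i * error s k $ j)"
  define g where "g = (\<lambda>s :: nat \<Rightarrow> real mat. Z_mat A B (s k) $$ (i, j))"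
  have f: "f \<in> borel_measurable (Pi\<^sub>M {..<k} (\<lambda>_. borel_mat m))"
    unfolding f_def using ij by (intro borel_measurable_times measurable_error) auto
  have "(\<lambda>Y. Z_mat A B Y $$ (i, j)) \<in> borel_measurable (borel_mat m)"
    using measurable_Z_mat ij by (simp add: measurable_mat_def)
  then have g: "g \<in> borel_measurable (Pi\<^sub>M {k} (\<lambda>_. borel_mat m))"
    unfolding g_def by (rule measurable_compose[OF measurable_component_singleton, rotated]) simp
  have "indep_var (Pi\<^sub>M {..<k} (\<lambda>_. borel_mat m)) (\<lambda>\<omega>. \<lambda>i\<in>{..<k}. Sk i \<omega>)
      (Pi\<^sub>M {k} (\<lambda>_. borel_mat m)) (\<lambda>\<omega>. \<lambda>i\<in>{k}. Sk i \<omega>)"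
    by (rule indep_var_restrict[OF indep]) auto
  from indep_var_compose[OF this f g]
  have "indep_var borel (f \<circ> (\<lambda>\<omega>. \<lambda>i\<in>{..<k}. Sk i \<omega>)) borel (g \<circ> (\<lambda>\<omega>. \<lambda>i\<in>{k}. Sk i \<omega>))" .
  \<comment> \<open>The restricted sequence is \<open>undefined\<close> from index \<open>k\<close>
    on, which \<open>error_cong\<close> shows to be harmless.\<close>
  moreover have "f \<circ> (\<lambda>\<omega>. \<lambda>i\<in>{..<k}. Sk i \<omega>) = (\<lambda>\<omega>. err k \<omega> $ i * err k \<omega> $ j)"
    using error_cong[of k "\<lambda>i\<in>{..<k}. Sk i _" "\<lambda>i. Sk i _"]
    by (auto simp: f_def err_def fun_eq_iff)
  moreover have "g \<circ> (\<lambda>\<omega>. \<lambda>i\<in>{k}. Sk i \<omega>) = (\<lambda>\<omega>. Z_mat A B (Sk k \<omega>) $$ (i, j))"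
    by (simp add: g_def fun_eq_iff)
  ultimately have ind: "indep_var borel (\<lambda>\<omega>. err k \<omega> $ i * err k \<omega> $ j) borel (\<lambda>\<omega>. Z_mat A B (Sk k \<omega>) $$ (i, j))"
    by simp
  note int = integrable_err_prod[OF ij, of k] integrable_Z_mat[OF ij measurable_Sk, of k]
  show ?int
    by (rule indep_var_integrable[OF ind int])
  show ?eq
    unfolding EZ_Sk[OF ij, of k] by (rule indep_var_lebesgue_integral[OF ind int])
qed

text \<open>Independence acts on each term of the double sum, where the expectation factors into a
  second moment of the error and an entry of \<open>EZ\<close>. Reassembling the sum replaces the
  random matrix by its mean while the error stays random.\<close>

lemma
  shows integrable_err_Z_quadratic: "integrable M (\<lambda>\<omega>. err k \<omega> \<bullet> (Z_mat A B (Sk k \<omega>) *\<^sub>v err k \<omega>))" (is ?int)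
    and integral_err_Z_quadratic: "(\<integral>\<omega>. err k \<omega> \<bullet> (Z_mat A B (Sk k \<omega>) *\<^sub>v err k \<omega>) \<partial>M)
      = (\<integral>\<omega>. err k \<omega> \<bullet> (EZ *\<^sub>v err k \<omega>) \<partial>M)" (is ?eq)
proof -
  have eq: "err k \<omega> \<bullet> (Z_mat A B (Sk k \<omega>) *\<^sub>v err k \<omega>)
      = (\<Sum>i<n. \<Sum>j<n. (err k \<omega> $ i * err k \<omega> $ j) * Z_mat A B (Sk k \<omega>) $$ (i, j))"
    if "\<omega> \<in> space M" for \<omega>
    by (rule quadratic_form_sum[OF Z_mat_props(1)[OF dim_row_Sk[OF that]] err_carrier])
  show ?int
    using integrable_double_sum[OF integrable_err_Z]
    by (subst Bochner_Integration.integrable_cong[OF refl eq]) auto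
  have "(\<integral>\<omega>. err k \<omega> \<bullet> (Z_mat A B (Sk k \<omega>) *\<^sub>v err k \<omega>) \<partial>M)
      = (\<integral>\<omega>. (\<Sum>i<n. \<Sum>j<n. (err k \<omega> $ i * err k \<omega> $ j) * Z_mat A B (Sk k \<omega>) $$ (i, j)) \<partial>M)"
    by (rule Bochner_Integration.integral_cong[OF refl eq])
  also have "\<dots> = (\<Sum>i<n. \<Sum>j<n. (\<integral>\<omega>. err k \<omega> $ i * err k \<omega> $ j \<partial>M) * EZ $$ (i, j))"
    by (subst integral_double_sum) (auto simp: integral_err_Z intro!: integrable_err_Z)
  finally show ?eq
    by (simp add: integral_err_quadratic[OF EZ_carrier])
qed

theorem expected_error_le:
  assumes n: "n \<ge> 1" and pd: "pos_def_mat EZ"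
  defines "l \<equiv> min_eigenvalue (inv_mat (sqrt_mat B) * EZ * inv_mat (sqrt_mat B))"
  shows "(\<integral>\<omega>. err k \<omega> \<bullet> (B *\<^sub>v err k \<omega>) \<partial>M) \<le> (1 - l) ^ k * ((x0 - xstar) \<bullet> (B *\<^sub>v (x0 - xstar)))"
proof (induction k)
  case 0
  then show ?case
    by (simp add: err_def error_def prob_space)
next
  case (Suc k)
  note l = whitened_min_eigenvalue[OF B EZ_carrier EZ_symmetric pd EZ_le_B n, folded l_def]
  have "(\<integral>\<omega>. err (Suc k) \<omega> \<bullet> (B *\<^sub>v err (Suc k) \<omega>) \<partial>M)
      = (\<integral>\<omega>. err k \<omega> \<bullet> (B *\<^sub>v err k \<omega>) - err k \<omega> \<bullet> (Z_mat A B (Sk k \<omega>) *\<^sub>v err k \<omega>) \<partial>M)"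
    by (rule Bochner_Integration.integral_cong[OF refl])
      (simp add: err_def error_norm_Suc[where s = "\<lambda>i. Sk i _"] dim_row_Sk)
  also have "\<dots> = (\<integral>\<omega>. err k \<omega> \<bullet> (B *\<^sub>v err k \<omega>) \<partial>M) - (\<integral>\<omega>. err k \<omega> \<bullet> (EZ *\<^sub>v err k \<omega>) \<partial>M)"
    by (simp add: integrable_err_quadratic[OF B(1)] integrable_err_Z_quadratic integral_err_Z_quadratic)
  \<comment> \<open>The Rayleigh bound for \<open>EZ\<close> holds at every value of the random
    error and is integrated.\<close>
  also have "\<dots> \<le> (\<integral>\<omega>. err k \<omega> \<bullet> (B *\<^sub>v err k \<omega>) \<partial>M) - (\<integral>\<omega>. l * (err k \<omega> \<bullet> (B *\<^sub>v err k \<omega>)) \<partial>M)"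
    using l(3) err_carrier
    by (intro diff_left_mono integral_mono integrable_mult_right integrable_err_quadratic B EZ_carrier) auto
  also have "\<dots> = (1 - l) * (\<integral>\<omega>. err k \<omega> \<bullet> (B *\<^sub>v err k \<omega>) \<partial>M)"
    by (simp add: algebra_simps)
  \<comment> \<open>Multiplying the induction hypothesis by \<open>1 - l\<close> requires
    \<open>l \<le> 1\<close>.\<close>
  also have "\<dots> \<le> (1 - l) * ((1 - l) ^ k * ((x0 - xstar) \<bullet> (B *\<^sub>v (x0 - xstar))))"
    using l(2) by (intro mult_left_mono Suc) auto
  finally show ?case
    by simp
qed

end

text \<open>Integrability belongs to the claim because the Bochner integral of a non-integrable
  function is 0, which would make the inequality alone vacuous. The hypothesis
  \<open>n \<ge> 1\<close> excludes an empty spectrum, for which the smallest eigenvalue has no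
  meaning.\<close>

theorem theorem4p6:
  fixes m n :: nat and A B :: "real mat" and b x0 xstar :: "real vec"
    and M :: "'a measure" and S :: "'a \<Rightarrow> real mat" and Sk :: "nat \<Rightarrow> 'a \<Rightarrow> real mat"
    and EZ :: "real mat" and \<rho> :: real
  assumes n: "n \<ge> 1"
    and A: "A \<in> carrier_mat m n"
    and b: "b \<in> carrier_vec m"
    and xstar: "xstar \<in> carrier_vec n" "A *\<^sub>v xstar = b"
    and B: "B \<in> carrier_mat n n" "symmetric_mat B" "pos_def_mat B"
    and M: "prob_space M"
    and S: "S \<in> measurable M (borel_mat m)"
    and indep: "prob_space.indep_vars M (\<lambda>_. borel_mat m) Sk UNIV"
    and copies: "\<And>k. distr M (borel_mat m) (Sk k) = distr M (borel_mat m) S"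
    and x0: "x0 \<in> carrier_vec n"
    and EZ: "EZ = expectation_mat M n n (\<lambda>\<omega>. Z_mat A B (S \<omega>))"
    and pd: "pos_def_mat EZ"
    and rho: "\<rho> = 1 - min_eigenvalue (inv_mat (sqrt_mat B) * EZ * inv_mat (sqrt_mat B))"
  shows "\<rho> < 1 \<and>
    (\<forall>k. integrable M (\<lambda>\<omega>. (norm_mat B (iterate A B b (\<lambda>i. Sk i \<omega>) x0 k - xstar))\<^sup>2) \<and>
      (\<integral>\<omega>. (norm_mat B (iterate A B b (\<lambda>i. Sk i \<omega>) x0 k - xstar))\<^sup>2 \<partial>M)
        \<le> \<rho> ^ k * (norm_mat B (x0 - xstar))\<^sup>2)"
proof -
  interpret prob_space M by (rule M)
  interpret R: randomized_iteration m n A B M b x0 xstar S Sk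
    by unfold_locales (use A B xstar x0 S indep copies in auto)
  have EZ': "EZ = R.EZ"
    by (simp add: EZ R.EZ_def)
  have norm: "(norm_mat B (iterate A B b (\<lambda>i. Sk i \<omega>) x0 k - xstar))\<^sup>2 = R.err k \<omega> \<bullet> (B *\<^sub>v R.err k \<omega>)" for k \<omega>
    using norm_mat_power2[OF B(1,3) R.err_carrier] by (simp add: R.err_def R.error_def)
  have norm0: "(norm_mat B (x0 - xstar))\<^sup>2 = (x0 - xstar) \<bullet> (B *\<^sub>v (x0 - xstar))"
    using norm_mat_power2[OF B(1,3), of "x0 - xstar"] x0 xstar(1) by simp
  note pd' = pd[unfolded EZ']
  have "\<rho> < 1"
    using whitened_min_eigenvalue(1)[OF B R.EZ_carrier R.EZ_symmetric pd' R.EZ_le_B n]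
    by (simp add: rho EZ')
  then show ?thesis
    unfolding norm norm0 using R.integrable_err_quadratic[OF B(1)] R.expected_error_le[OF n pd']
    by (simp add: rho EZ')
qed

end
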